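(* Let $n>0$. Then the poset $(\mathcal{W}(B_n),\leqslant_R)$ is isomorphic to the product poset $(B_{\lceil n/2\rceil},\leqslant_R)\times\mathcal{P}([\lfloor n/2\rfloor])$, where $\mathcal{P}([\lfloor n/2\rfloor])$ is ordered by inclusion. In particular, $(\mathcal{W}(B_n),\leqslant_R)$ is a complemented lattice.
   Context: For $k\ge1$, $B_k$ is the group of bijections $w$ of $[\pm k]=\{-k,\dots,-1,1,\dots,k\}$ with $w(-a)=-w(a)$; it is a Coxeter group with simple generators $S=\{(1,-1)\}\cup\{(a,a+1)(-a,-a-1):a\in[k-1]\}$ and length $\ell_B$. The right weak order $\leqslant_R$ is the partial order on $B_k$ generated by the covers $u\vartriangleleft_R us$ for $s\in S$ with $\ell_B(us)=\ell_B(u)+1$. For $a\in[n]$ let $a^*=a-1$ if $a$ even, $a^*=a+1$ if $a$ odd and $a+1\le n$, $a^*=n$ otherwise. The signed Wachs permutations are $\mathcal{W}(B_n)=\{v\in B_n: |v^{-1}(a)-v^{-1}(a^* )|\le1\ \forall a\in[n-1]\}$, ordered by the restriction of $\leqslant_R$ on $B_n$. *)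

theory Defs
  imports Complex_Main "HOL-Algebra.Lattice" "HOL-Combinatorics.Permutations"
begin

definition pm_interval :: "nat \<Rightarrow> int set" where
  "pm_interval k = {- int k..int k} - {0}"

text \<open>Signed permutations are extended by the identity outside \<^term>\<open>pm_interval k\<close>
  (this is part of \<^const>\<open>permutes\<close>), so that the group operation is composition and
  \<^term>\<open>u \<circ> s\<close> applies \<^term>\<open>s\<close> first.\<close>

definition signed_perms :: "nat \<Rightarrow> (int \<Rightarrow> int) set" where
  "signed_perms k =
     {w. w permutes pm_interval k \<and> (\<forall>a\<in>pm_interval k. w (- a) = - w a)}"

definition simple_gens :: "nat \<Rightarrow> (int \<Rightarrow> int) set" where
  "simple_gens k =
     {Transposition.transpose 1 (- 1)} \<union>
     {Transposition.transpose a (a + 1) \<circ> Transposition.transpose (- a) (- a - 1) | a.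
        a \<in> {1..int k - 1}}"

definition length_B :: "nat \<Rightarrow> (int \<Rightarrow> int) \<Rightarrow> nat" where
  "length_B k w =
     (LEAST r. \<exists>ss. length ss = r \<and> set ss \<subseteq> simple_gens k \<and> w = foldr (\<circ>) ss id)"

definition weak_cover :: "nat \<Rightarrow> (int \<Rightarrow> int) \<Rightarrow> (int \<Rightarrow> int) \<Rightarrow> bool" where
  "weak_cover k u v \<longleftrightarrow>
     u \<in> signed_perms k \<and>
     (\<exists>s\<in>simple_gens k. v = u \<circ> s \<and> length_B k (u \<circ> s) = length_B k u + 1)"

definition weak_le :: "nat \<Rightarrow> (int \<Rightarrow> int) \<Rightarrow> (int \<Rightarrow> int) \<Rightarrow> bool" where
  "weak_le k = (weak_cover k)\<^sup>*\<^sup>*"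

definition star :: "nat \<Rightarrow> nat \<Rightarrow> nat" where
  "star n a = (if even a then a - 1 else if a + 1 \<le> n then a + 1 else n)"

definition signed_wachs :: "nat \<Rightarrow> (int \<Rightarrow> int) set" where
  "signed_wachs n =
     {v \<in> signed_perms n.
        \<forall>a\<in>{1..n - 1}. \<bar>inv_into UNIV v (int a) - inv_into UNIV v (int (star n a))\<bar> \<le> 1}"

definition B_poset :: "nat \<Rightarrow> (int \<Rightarrow> int) gorder" where
  "B_poset k = \<lparr>carrier = signed_perms k, eq = (=), le = weak_le k\<rparr>"

definition wachs_poset :: "nat \<Rightarrow> (int \<Rightarrow> int) gorder" where
  "wachs_poset n = \<lparr>carrier = signed_wachs n, eq = (=), le = weak_le n\<rparr>"

definition powerset_poset :: "'a set \<Rightarrow> 'a set gorder" where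
  "powerset_poset X = \<lparr>carrier = Pow X, eq = (=), le = (\<subseteq>)\<rparr>"

definition prod_poset :: "'a gorder \<Rightarrow> 'b gorder \<Rightarrow> ('a \<times> 'b) gorder" where
  "prod_poset P Q =
     \<lparr>carrier = carrier P \<times> carrier Q, eq = (=),
      le = (\<lambda>x y. fst x \<sqsubseteq>\<^bsub>P\<^esub> fst y \<and> snd x \<sqsubseteq>\<^bsub>Q\<^esub> snd y)\<rparr>"

definition poset_isomorphic :: "'a gorder \<Rightarrow> 'b gorder \<Rightarrow> bool" where
  "poset_isomorphic P Q \<longleftrightarrow>
     partial_order P \<and> partial_order Q \<and>
     (\<exists>f. bij_betw f (carrier P) (carrier Q) \<and> order_emb P Q f)"

locale complemented_bounded_lattice = bounded_lattice +
  assumes complement_exists: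
    "x \<in> carrier L \<Longrightarrow> \<exists>y\<in>carrier L. x \<sqinter> y = \<bottom> \<and> x \<squnion> y = \<top>"

end

theory Submission
  imports Defs
begin

text \<open>
  Record a signed permutation \<open>v\<close> by its inversion set in terms of values: the pairs \<open>a < b\<close> with
  \<open>v\<^sup>-\<^sup>1(b) < v\<^sup>-\<^sup>1(a)\<close>. The right weak order is inclusion of inversion sets, and the inversion sets
  are exactly the biclosed sets, i.e. those stable under \<open>(a, b) \<mapsto> (-b, -a)\<close> that are transitive
  and have transitive complement. The transitive closure of a union of two biclosed sets is
  biclosed, which gives joins; taking complements then gives meets and lattice complements.

  In a signed Wachs permutation the values \<open>2i - 1\<close> and \<open>2i\<close> stand side by side, so whether a pair
  from two different blocks is inverted depends on the blocks only. The inversion set is therefore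
  the same data as a biclosed set of pairs of blocks, that is a signed permutation of the blocks,
  together with the set of blocks that are internally inverted.
\<close>

subsection \<open>Posets and their isomorphisms\<close>

lemma partial_orderI:
  assumes "reflp_on C R" "antisymp_on C R" "transp_on C R"
  shows "partial_order \<lparr>carrier = C, eq = (=), le = R\<rparr>"
  using assms by unfold_locales (auto dest: reflp_onD antisymp_onD transp_onD)

lemma poset_isomorphicI:
  assumes P: "partial_order P" and Q: "partial_order Q" and image: "f ` carrier P = carrier Q"
    and le_iff: "\<forall>x\<in>carrier P. \<forall>y\<in>carrier P. f x \<sqsubseteq>\<^bsub>Q\<^esub> f y \<longleftrightarrow> x \<sqsubseteq>\<^bsub>P\<^esub> y"
  shows "poset_isomorphic P Q"
proof -
  interpret P: partial_order P by (fact P)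
  interpret Q: partial_order Q by (fact Q)
  have "inj_on f (carrier P)"
    using image le_iff by (intro inj_onI P.le_antisym) (metis Q.le_refl image_eqI)+
  moreover have "order_emb P Q f"
    using le_iff P.weak_partial_order_axioms Q.weak_partial_order_axioms
    by (simp add: order_emb_def)
  ultimately show ?thesis
    using P Q image by (auto simp: poset_isomorphic_def bij_betw_def)
qed

lemma poset_isomorphicE:
  assumes "poset_isomorphic P Q"
  obtains f where "partial_order P" "partial_order Q" "f ` carrier P = carrier Q"
    "\<forall>x\<in>carrier P. \<forall>y\<in>carrier P. f x \<sqsubseteq>\<^bsub>Q\<^esub> f y \<longleftrightarrow> x \<sqsubseteq>\<^bsub>P\<^esub> y"
  using assms unfolding poset_isomorphic_def bij_betw_def order_emb_def by blast

lemma poset_isomorphic_refl: "partial_order P \<Longrightarrow> poset_isomorphic P P"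
  by (rule poset_isomorphicI[of P P id]) auto

lemma poset_isomorphic_sym:
  assumes "poset_isomorphic P Q"
  shows "poset_isomorphic Q P"
proof -
  obtain f where po: "partial_order P" "partial_order Q"
    and bij: "bij_betw f (carrier P) (carrier Q)"
    and le_iff: "\<forall>x\<in>carrier P. \<forall>y\<in>carrier P. f x \<sqsubseteq>\<^bsub>Q\<^esub> f y \<longleftrightarrow> x \<sqsubseteq>\<^bsub>P\<^esub> y"
    using assms by (auto simp: poset_isomorphic_def order_emb_def)
  let ?g = "inv_into (carrier P) f"
  have "?g ` carrier Q = carrier P"
    using bij_betw_inv_into[OF bij] by (rule bij_betw_imp_surj_on)
  moreover have "?g x \<sqsubseteq>\<^bsub>P\<^esub> ?g y \<longleftrightarrow> x \<sqsubseteq>\<^bsub>Q\<^esub> y" if "x \<in> carrier Q" "y \<in> carrier Q" for x y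
    using that le_iff bij_betw_apply[OF bij_betw_inv_into[OF bij]] bij_betw_inv_into_right[OF bij]
    by metis
  ultimately show ?thesis
    using po by (intro poset_isomorphicI) auto
qed

lemma poset_isomorphic_trans [trans]:
  assumes "poset_isomorphic P Q" "poset_isomorphic Q R"
  shows "poset_isomorphic P R"
proof -
  obtain f where f: "partial_order P" "partial_order Q" "f ` carrier P = carrier Q"
      "\<forall>x\<in>carrier P. \<forall>y\<in>carrier P. f x \<sqsubseteq>\<^bsub>Q\<^esub> f y \<longleftrightarrow> x \<sqsubseteq>\<^bsub>P\<^esub> y"
    using assms(1) by (rule poset_isomorphicE)
  obtain g where g: "partial_order Q" "partial_order R" "g ` carrier Q = carrier R"
      "\<forall>x\<in>carrier Q. \<forall>y\<in>carrier Q. g x \<sqsubseteq>\<^bsub>R\<^esub> g y \<longleftrightarrow> x \<sqsubseteq>\<^bsub>Q\<^esub> y"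
    using assms(2) by (rule poset_isomorphicE)
  have "(g \<circ> f) ` carrier P = carrier R"
    by (simp only: image_comp[symmetric] f(3) g(3))
  moreover have "\<forall>x\<in>carrier P. \<forall>y\<in>carrier P. (g \<circ> f) x \<sqsubseteq>\<^bsub>R\<^esub> (g \<circ> f) y \<longleftrightarrow> x \<sqsubseteq>\<^bsub>P\<^esub> y"
    using f(4) g(4) f(3)[symmetric] by simp
  ultimately show ?thesis
    using f(1) g(2) by (intro poset_isomorphicI)
qed

lemma partial_order_prod_poset:
  assumes "partial_order P" "partial_order Q"
  shows "partial_order (prod_poset P Q)"
proof -
  interpret P: partial_order P by fact
  interpret Q: partial_order Q by fact
  show ?thesis
    by unfold_locales (auto simp: prod_poset_def intro: P.le_trans Q.le_trans)
qed

lemma poset_isomorphic_prod_poset: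
  assumes "poset_isomorphic P P'" "poset_isomorphic Q Q'"
  shows "poset_isomorphic (prod_poset P Q) (prod_poset P' Q')"
proof -
  obtain f where f: "partial_order P" "partial_order P'" "f ` carrier P = carrier P'"
      "\<forall>x\<in>carrier P. \<forall>y\<in>carrier P. f x \<sqsubseteq>\<^bsub>P'\<^esub> f y \<longleftrightarrow> x \<sqsubseteq>\<^bsub>P\<^esub> y"
    using assms(1) by (rule poset_isomorphicE)
  obtain g where g: "partial_order Q" "partial_order Q'" "g ` carrier Q = carrier Q'"
      "\<forall>x\<in>carrier Q. \<forall>y\<in>carrier Q. g x \<sqsubseteq>\<^bsub>Q'\<^esub> g y \<longleftrightarrow> x \<sqsubseteq>\<^bsub>Q\<^esub> y"
    using assms(2) by (rule poset_isomorphicE)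
  have "map_prod f g ` carrier (prod_poset P Q) = carrier (prod_poset P' Q')"
    using map_prod_surj_on[OF f(3) g(3)] by (simp add: prod_poset_def)
  moreover have "map_prod f g x \<sqsubseteq>\<^bsub>prod_poset P' Q'\<^esub> map_prod f g y \<longleftrightarrow> x \<sqsubseteq>\<^bsub>prod_poset P Q\<^esub> y"
    if "x \<in> carrier (prod_poset P Q)" "y \<in> carrier (prod_poset P Q)" for x y
    using that f(4) g(4) by (auto simp: prod_poset_def)
  ultimately show ?thesis
    using f(1,2) g(1,2)
    by (intro poset_isomorphicI[of _ _ "map_prod f g"] partial_order_prod_poset) auto
qed

lemma is_lub_image:
  assumes emb: "order_emb P Q f" and image: "f ` carrier P = carrier Q"
    and A: "A \<subseteq> carrier P" and s: "is_lub P s A"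
  shows "is_lub Q (f s) (f ` A)"
proof (rule least_UpperI)
  have le_iff: "f x \<sqsubseteq>\<^bsub>Q\<^esub> f y \<longleftrightarrow> x \<sqsubseteq>\<^bsub>P\<^esub> y" if "x \<in> carrier P" "y \<in> carrier P" for x y
    using emb that by (simp add: order_emb_def)
  have s_in: "s \<in> carrier P" using s by (rule least_closed)
  show "x \<sqsubseteq>\<^bsub>Q\<^esub> f s" if "x \<in> f ` A" for x
    using that A le_iff[OF _ s_in] least_Upper_above[OF s _ A] by auto
  show "f s \<sqsubseteq>\<^bsub>Q\<^esub> y" if "y \<in> Upper Q (f ` A)" for y
  proof -
    have "y \<in> f ` carrier P"
      using that Upper_closed[of Q "f ` A"] unfolding image by (rule subsetD[rotated])
    then obtain u where u: "y = f u" "u \<in> carrier P" by (rule imageE)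
    have "u \<in> Upper P A"
    proof (rule Upper_memI)
      fix x assume "x \<in> A"
      then have "f x \<sqsubseteq>\<^bsub>Q\<^esub> f u" using that u(1) A image by (auto simp: Upper_def)
      then show "x \<sqsubseteq>\<^bsub>P\<^esub> u" using le_iff u(2) A \<open>x \<in> A\<close> by auto
    qed (fact u)
    then show ?thesis using le_iff[OF s_in u(2)] u(1) least_le[OF s] by simp
  qed
  show "f ` A \<subseteq> carrier Q" "f s \<in> carrier Q" using A s_in image by auto
qed

lemma is_glb_image:
  assumes "order_emb P Q f" "f ` carrier P = carrier Q" "A \<subseteq> carrier P" "is_glb P i A"
  shows "is_glb Q (f i) (f ` A)"
proof -
  have "order_emb (inv_gorder P) (inv_gorder Q) f"
    using assms(1) by (simp add: order_emb_def dual_weak_order_iff)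
  from is_lub_image[OF this, of A i] assms(2-4) show ?thesis by simp
qed

lemma is_lub_prod_poset:
  assumes "is_lub P s (fst ` A)" "is_lub Q t (snd ` A)" "A \<subseteq> carrier P \<times> carrier Q"
  shows "is_lub (prod_poset P Q) (s, t) A"
proof -
  have "Upper (prod_poset P Q) A = Upper P (fst ` A) \<times> Upper Q (snd ` A)"
    using assms(3) by (fastforce simp: Upper_def prod_poset_def)
  then show ?thesis
    using assms(1,2) Upper_closed[of P "fst ` A"] Upper_closed[of Q "snd ` A"]
    by (simp add: least_def prod_poset_def Sigma_mono)
qed

lemma is_glb_prod_poset:
  assumes "is_glb P i (fst ` A)" "is_glb Q j (snd ` A)" "A \<subseteq> carrier P \<times> carrier Q"
  shows "is_glb (prod_poset P Q) (i, j) A"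
proof -
  have "prod_poset (inv_gorder P) (inv_gorder Q) = inv_gorder (prod_poset P Q)"
    by (simp add: prod_poset_def)
  then show ?thesis using is_lub_prod_poset[of "inv_gorder P" i A "inv_gorder Q" j] assms by simp
qed

subsection \<open>Complemented lattices\<close>

lemma complemented_bounded_latticeI:
  fixes L (structure)
  assumes "partial_order L" and bot: "is_lub L b {}" and top: "is_glb L t {}"
    and lub: "\<And>x y. x \<in> carrier L \<Longrightarrow> y \<in> carrier L \<Longrightarrow> \<exists>s. is_lub L s {x, y}"
    and glb: "\<And>x y. x \<in> carrier L \<Longrightarrow> y \<in> carrier L \<Longrightarrow> \<exists>i. is_glb L i {x, y}"
    and compl: "\<And>x. x \<in> carrier L \<Longrightarrow> \<exists>y\<in>carrier L. is_glb L b {x, y} \<and> is_lub L t {x, y}"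
  shows "complemented_bounded_lattice L"
proof -
  interpret partial_order L by fact
  interpret bounded_lattice L
    by unfold_locales (use bot top lub glb in auto)
  have "b = \<bottom>" "t = \<top>"
    using bot top by (auto intro: least_unique bottom_least greatest_unique top_greatest)
  moreover have "x \<sqinter> y = i" if "is_glb L i {x, y}" for x y i
    unfolding meet_def inf_def using that greatest_unique[OF _ that] by (rule some_equality)
  moreover have "x \<squnion> y = s" if "is_lub L s {x, y}" for x y s
    unfolding join_def sup_def using that least_unique[OF _ that] by (rule some_equality)
  ultimately show ?thesis
    using compl by unfold_locales blast
qed

lemma complement_is_glb_is_lub:
  fixes L (structure)
  assumes L: "complemented_bounded_lattice L" and x: "x \<in> carrier L"
  shows "\<exists>y\<in>carrier L. is_glb L \<bottom> {x, y} \<and> is_lub L \<top> {x, y}"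
proof -
  interpret bounded_lattice L using L by (rule complemented_bounded_lattice.axioms)
  obtain y where y: "y \<in> carrier L" "x \<sqinter> y = \<bottom>" "x \<squnion> y = \<top>"
    using complemented_bounded_lattice.complement_exists[OF L x] by blast
  have "is_glb L (x \<sqinter> y) {x, y}"
    unfolding meet_def inf_def by (rule someI_ex) (rule inf_of_two_exists[OF x y(1)])
  moreover have "is_lub L (x \<squnion> y) {x, y}"
    unfolding join_def sup_def by (rule someI_ex) (rule sup_of_two_exists[OF x y(1)])
  ultimately show ?thesis using y by metis
qed

lemma complemented_bounded_lattice_isomorphic:
  assumes "poset_isomorphic P Q" and P: "complemented_bounded_lattice P"
  shows "complemented_bounded_lattice Q"
proof -
  interpret P: bounded_lattice P using P by (rule complemented_bounded_lattice.axioms)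
  obtain f where Q: "partial_order Q" and f: "order_emb P Q f"
    and image: "f ` carrier P = carrier Q"
    using assms(1) by (auto simp: poset_isomorphic_def bij_betw_def)
  have lub: "is_lub Q (f s) {f x, f y}"
    if "is_lub P s {x, y}" "x \<in> carrier P" "y \<in> carrier P" for s x y
    using is_lub_image[OF f image, of "{x, y}" s] that by simp
  have glb: "is_glb Q (f i) {f x, f y}"
    if "is_glb P i {x, y}" "x \<in> carrier P" "y \<in> carrier P" for i x y
    using is_glb_image[OF f image, of "{x, y}" i] that by simp
  show ?thesis
  proof (rule complemented_bounded_latticeI[OF Q, unfolded image[symmetric]])
    show "is_lub Q (f \<bottom>\<^bsub>P\<^esub>) {}" "is_glb Q (f \<top>\<^bsub>P\<^esub>) {}"
      using is_lub_image[OF f image, of "{}"] is_glb_image[OF f image, of "{}"]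
        P.bottom_least P.top_greatest by simp_all
  next
    fix x y assume "x \<in> f ` carrier P" "y \<in> f ` carrier P"
    then show "\<exists>s. is_lub Q s {x, y}" "\<exists>i. is_glb Q i {x, y}"
      using P.sup_of_two_exists P.inf_of_two_exists lub glb by blast+
  next
    fix x assume "x \<in> f ` carrier P"
    then show "\<exists>y\<in>f ` carrier P. is_glb Q (f \<bottom>\<^bsub>P\<^esub>) {x, y} \<and> is_lub Q (f \<top>\<^bsub>P\<^esub>) {x, y}"
      using complement_is_glb_is_lub[OF P] lub glb by blast
  qed
qed

lemma complemented_bounded_lattice_prod_poset:
  assumes P: "complemented_bounded_lattice P" and Q: "complemented_bounded_lattice Q"
  shows "complemented_bounded_lattice (prod_poset P Q)" (is "complemented_bounded_lattice ?R")
proof -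
  interpret P: bounded_lattice P using P by (rule complemented_bounded_lattice.axioms)
  interpret Q: bounded_lattice Q using Q by (rule complemented_bounded_lattice.axioms)
  have carrier: "carrier ?R = carrier P \<times> carrier Q" by (simp add: prod_poset_def)
  have lub: "is_lub ?R (s, s') {(x, x'), (y, y')}"
    if "is_lub P s {x, y}" "is_lub Q s' {x', y'}"
      "x \<in> carrier P" "y \<in> carrier P" "x' \<in> carrier Q" "y' \<in> carrier Q" for s s' x x' y y'
    using that by (intro is_lub_prod_poset) auto
  have glb: "is_glb ?R (i, i') {(x, x'), (y, y')}"
    if "is_glb P i {x, y}" "is_glb Q i' {x', y'}"
      "x \<in> carrier P" "y \<in> carrier P" "x' \<in> carrier Q" "y' \<in> carrier Q" for i i' x x' y y'
    using that by (intro is_glb_prod_poset) auto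
  show ?thesis
  proof (rule complemented_bounded_latticeI, unfold carrier)
    show "partial_order ?R"
      by (intro partial_order_prod_poset P.partial_order_axioms Q.partial_order_axioms)
    show "is_lub ?R (\<bottom>\<^bsub>P\<^esub>, \<bottom>\<^bsub>Q\<^esub>) {}" "is_glb ?R (\<top>\<^bsub>P\<^esub>, \<top>\<^bsub>Q\<^esub>) {}"
      using is_lub_prod_poset[of P _ "{}" Q] is_glb_prod_poset[of P _ "{}" Q]
        P.bottom_least Q.bottom_least P.top_greatest Q.top_greatest by simp_all
  next
    fix z w assume "z \<in> carrier P \<times> carrier Q" "w \<in> carrier P \<times> carrier Q"
    then show "\<exists>s. is_lub ?R s {z, w}" "\<exists>i. is_glb ?R i {z, w}"
      using P.sup_of_two_exists Q.sup_of_two_exists P.inf_of_two_exists Q.inf_of_two_exists lub glb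
      by (metis mem_Times_iff prod.collapse)+
  next
    fix z assume "z \<in> carrier P \<times> carrier Q"
    then obtain x x' where z: "z = (x, x')" "x \<in> carrier P" "x' \<in> carrier Q" by blast
    obtain y where y: "y \<in> carrier P" "is_glb P \<bottom>\<^bsub>P\<^esub> {x, y}" "is_lub P \<top>\<^bsub>P\<^esub> {x, y}"
      using complement_is_glb_is_lub[OF P z(2)] by blast
    obtain y' where y': "y' \<in> carrier Q" "is_glb Q \<bottom>\<^bsub>Q\<^esub> {x', y'}" "is_lub Q \<top>\<^bsub>Q\<^esub> {x', y'}"
      using complement_is_glb_is_lub[OF Q z(3)] by blast
    show "\<exists>w\<in>carrier P \<times> carrier Q.
        is_glb ?R (\<bottom>\<^bsub>P\<^esub>, \<bottom>\<^bsub>Q\<^esub>) {z, w} \<and> is_lub ?R (\<top>\<^bsub>P\<^esub>, \<top>\<^bsub>Q\<^esub>) {z, w}"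
      using z y y' lub glb by (intro bexI[of _ "(y, y')"]) simp_all
  qed
qed

text \<open>De Morgan: an order-reversing involution turns joins into meets.\<close>

lemma complemented_bounded_latticeI_orthocomplement:
  fixes L (structure)
  assumes L: "partial_order L" and bot: "is_lub L b {}"
    and lub: "\<And>x y. x \<in> carrier L \<Longrightarrow> y \<in> carrier L \<Longrightarrow> \<exists>s. is_lub L s {x, y}"
    and closed: "\<And>x. x \<in> carrier L \<Longrightarrow> c x \<in> carrier L"
    and involution: "\<And>x. x \<in> carrier L \<Longrightarrow> c (c x) = x"
    and antimono: "\<And>x y. x \<in> carrier L \<Longrightarrow> y \<in> carrier L \<Longrightarrow> x \<sqsubseteq> y \<Longrightarrow> c y \<sqsubseteq> c x"
    and compl: "\<And>x. x \<in> carrier L \<Longrightarrow> is_lub L (c b) {x, c x}"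
  shows "complemented_bounded_lattice L"
proof -
  interpret partial_order L by fact
  have "c y \<sqsubseteq> c x \<longleftrightarrow> x \<sqsubseteq> y" if "x \<in> carrier L" "y \<in> carrier L" for x y
    using antimono[of x y] antimono[of "c y" "c x"] closed involution that by auto
  then have emb: "order_emb L (inv_gorder L) c"
    using weak_partial_order_axioms by (simp add: order_emb_def dual_weak_order)
  have image: "c ` carrier L = carrier (inv_gorder L)"
    by (simp add: set_eq_iff image_iff) (metis closed involution)
  have glb: "is_glb L (c s) {c x, c y}"
    if "is_lub L s {x, y}" "x \<in> carrier L" "y \<in> carrier L" for s x y
    using is_lub_image[OF emb image, of "{x, y}" s] that by simp
  show ?thesis
  proof (rule complemented_bounded_latticeI[OF L bot _ lub])
    show "is_glb L (c b) {}" using is_lub_image[OF emb image, of "{}"] bot by simp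
    show "\<exists>i. is_glb L i {x, y}" if "x \<in> carrier L" "y \<in> carrier L" for x y
      using lub[of "c x" "c y"] glb[of _ "c x" "c y"] closed involution that by metis
    show "\<exists>y\<in>carrier L. is_glb L b {x, y} \<and> is_lub L (c b) {x, y}" if "x \<in> carrier L" for x
    proof (intro bexI conjI)
      have "b \<in> carrier L" using bot by simp
      then show "is_glb L b {x, c x}"
        using glb[OF compl[OF that]] that closed involution by (simp add: insert_commute)
    qed (use that closed compl in auto)
  qed
qed

definition inclusion_poset :: "'a set set \<Rightarrow> 'a set gorder" where
  "inclusion_poset F = \<lparr>carrier = F, eq = (=), le = (\<subseteq>)\<rparr>"

lemma inclusion_poset_simps [simp]:
  "carrier (inclusion_poset F) = F" "le (inclusion_poset F) = (\<subseteq>)"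
  by (simp_all add: inclusion_poset_def)

lemma powerset_poset_eq_inclusion_poset: "powerset_poset X = inclusion_poset (Pow X)"
  by (simp add: powerset_poset_def inclusion_poset_def)

lemma partial_order_inclusion_poset: "partial_order (inclusion_poset F)"
  unfolding inclusion_poset_def
  by (rule partial_orderI) (auto intro: reflp_onI antisymp_onI transp_onI)

lemma partial_order_powerset_poset: "partial_order (powerset_poset X)"
  unfolding powerset_poset_eq_inclusion_poset by (rule partial_order_inclusion_poset)

lemma is_lub_inclusion_poset_iff:
  assumes "\<A> \<subseteq> F"
  shows "is_lub (inclusion_poset F) C \<A> \<longleftrightarrow> C \<in> F \<and> \<Union>\<A> \<subseteq> C \<and> (\<forall>D\<in>F. \<Union>\<A> \<subseteq> D \<longrightarrow> C \<subseteq> D)"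
proof -
  have "Upper (inclusion_poset F) \<A> = {D \<in> F. \<Union>\<A> \<subseteq> D}"
    using assms by (auto simp: Upper_def)
  then show ?thesis by (auto simp: least_def)
qed

lemma complemented_bounded_lattice_inclusion_poset:
  assumes "F \<subseteq> Pow U" and empty: "{} \<in> F" and compl: "\<And>A. A \<in> F \<Longrightarrow> U - A \<in> F"
    and join: "\<And>A B. A \<in> F \<Longrightarrow> B \<in> F \<Longrightarrow> \<exists>C\<in>F. A \<union> B \<subseteq> C \<and> (\<forall>D\<in>F. A \<union> B \<subseteq> D \<longrightarrow> C \<subseteq> D)"
  shows "complemented_bounded_lattice (inclusion_poset F)"
proof (rule complemented_bounded_latticeI_orthocomplement[where b = "{}" and c = "\<lambda>A. U - A"])
  show "partial_order (inclusion_poset F)" by (rule partial_order_inclusion_poset)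
  show "is_lub (inclusion_poset F) {} {}" using empty by (simp add: least_def)
next
  fix A B assume "A \<in> carrier (inclusion_poset F)" "B \<in> carrier (inclusion_poset F)"
  then show "\<exists>C. is_lub (inclusion_poset F) C {A, B}"
    using join[of A B] by (simp add: is_lub_inclusion_poset_iff) blast
next
  fix A assume A: "A \<in> carrier (inclusion_poset F)"
  moreover have "A \<union> (U - A) = U" using A assms(1) by auto
  ultimately show "is_lub (inclusion_poset F) (U - {}) {A, U - A}"
    using compl[OF empty] compl[of A] by (simp add: is_lub_inclusion_poset_iff)
qed (use assms(1) compl in auto)

lemma complemented_bounded_lattice_powerset_poset: "complemented_bounded_lattice (powerset_poset X)"
  unfolding powerset_poset_eq_inclusion_poset
proof (rule complemented_bounded_lattice_inclusion_poset[where U = X])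
  fix A B assume "A \<in> Pow X" "B \<in> Pow X"
  then show "\<exists>C\<in>Pow X. A \<union> B \<subseteq> C \<and> (\<forall>D\<in>Pow X. A \<union> B \<subseteq> D \<longrightarrow> C \<subseteq> D)"
    by (intro bexI[of _ "A \<union> B"]) auto
qed auto

subsection \<open>Consecutive elements of finite linear orders\<close>

definition consecutive :: "'a::linorder set \<Rightarrow> 'a \<Rightarrow> 'a \<Rightarrow> bool" where
  "consecutive A x y \<longleftrightarrow> x \<in> A \<and> y \<in> A \<and> x < y \<and> A \<inter> {x<..<y} = {}"

lemma transp_on_if_consecutive:
  assumes "finite A" and trans: "transp_on A R"
    and consecutive: "\<And>x y. consecutive A x y \<Longrightarrow> R x y"
    and "x \<in> A" "y \<in> A" "x < y"
  shows "R x y"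
  using assms(4-6)
proof (induction "card (A \<inter> {x<..<y})" arbitrary: x y rule: less_induct)
  case less
  show ?case
  proof (cases "consecutive A x y")
    case True
    then show ?thesis by (rule consecutive)
  next
    case False
    then obtain z where z: "z \<in> A" "x < z" "z < y"
      using less.prems by (auto simp: consecutive_def)
    then have "A \<inter> {x<..<z} \<subset> A \<inter> {x<..<y}" "A \<inter> {z<..<y} \<subset> A \<inter> {x<..<y}"
      by auto
    then have "card (A \<inter> {x<..<z}) < card (A \<inter> {x<..<y})"
        "card (A \<inter> {z<..<y}) < card (A \<inter> {x<..<y})"
      using \<open>finite A\<close> by (simp_all add: psubset_card_mono)
    then have "R x z" "R z y"
      using less.prems z by (simp_all add: less.hyps)
    then show ?thesis using transp_onD[OF trans, of x z y] less.prems z(1) by simp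
  qed
qed

lemma strict_mono_on_finite_le:
  fixes f :: "'a::linorder \<Rightarrow> 'a"
  assumes "finite A" "strict_mono_on A f" "f ` A \<subseteq> A" "x \<in> A"
  shows "x \<le> f x"
proof (rule ccontr)
  assume "\<not> x \<le> f x"
  define D where "D = {y \<in> A. f y < y}"
  have "finite D" "D \<noteq> {}" using assms(1,4) \<open>\<not> x \<le> f x\<close> by (auto simp: D_def)
  then have min: "Min D \<in> D" "\<And>y. y \<in> D \<Longrightarrow> Min D \<le> y" by simp_all
  then have "f (Min D) \<in> A" "f (f (Min D)) < f (Min D)"
    using assms(2,3) by (auto simp: D_def strict_mono_on_def)
  then show False using min by (force simp: D_def)
qed

lemma strict_mono_on_permutes_eq_id:
  fixes f :: "'a::linorder \<Rightarrow> 'a"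
  assumes "finite A" "strict_mono_on A f" "f permutes A"
  shows "f = id"
proof
  fix x
  have "inv f y < inv f z \<longleftrightarrow> y < z" if "y \<in> A" "z \<in> A" for y z
    using that strict_mono_on_less[OF assms(2), of "inv f y" "inv f z"] assms(3)
    by (simp add: permutes_inverses permutes_in_image permutes_inv)
  then have "strict_mono_on A (inv f)" by (simp add: strict_mono_on_def)
  then have "x \<le> f x" "f x \<le> x" if "x \<in> A"
    using that strict_mono_on_finite_le[OF assms(1,2), of x]
      strict_mono_on_finite_le[OF assms(1), of "inv f" "f x"] assms(3)
    by (auto simp: permutes_image permutes_inv permutes_inverses permutes_in_image)
  then show "f x = id x" using assms(3) by (cases "x \<in> A") (auto simp: permutes_not_in)
qed

subsection \<open>Signed permutations\<close>

lemma pm_interval_iff: "a \<in> pm_interval k \<longleftrightarrow> a \<noteq> 0 \<and> \<bar>a\<bar> \<le> int k"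
  by (auto simp: pm_interval_def)

lemma finite_pm_interval [simp]: "finite (pm_interval k)"
  by (simp add: pm_interval_def)

lemma uminus_in_pm_interval [simp]: "- a \<in> pm_interval k \<longleftrightarrow> a \<in> pm_interval k"
  by (simp add: pm_interval_iff)

lemma consecutive_pm_intervalE:
  assumes "consecutive (pm_interval k) i j"
  obtains (middle) "i = - 1" "j = 1"
    | (positive) "j = i + 1" "1 \<le> i" "i < int k"
    | (negative) "j = i + 1" "i < -1" "- int k \<le> i"
proof -
  have ij: "i \<noteq> 0" "j \<noteq> 0" "\<bar>i\<bar> \<le> int k" "\<bar>j\<bar> \<le> int k" "i < j"
    and gap: "\<And>c. c \<in> pm_interval k \<Longrightarrow> i < c \<Longrightarrow> j \<le> c"
    using assms by (auto simp: consecutive_def pm_interval_iff[of i] pm_interval_iff[of j]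
        disjoint_iff not_less)
  show thesis
  proof (cases "i = -1")
    case True
    then show thesis using gap[of 1] ij middle by (force simp: pm_interval_iff)
  next
    case False
    then have "j = i + 1" using gap[of "i + 1"] ij by (force simp: pm_interval_iff)
    then show thesis using False ij positive negative by force
  qed
qed

lemma signed_perms_permutes: "w \<in> signed_perms k \<Longrightarrow> w permutes pm_interval k"
  by (simp add: signed_perms_def)

lemma signed_perms_uminus: "w \<in> signed_perms k \<Longrightarrow> w (- a) = - w a"
  by (cases "a \<in> pm_interval k") (auto simp: signed_perms_def permutes_not_in)

lemma signed_perms_in_iff: "w \<in> signed_perms k \<Longrightarrow> w a \<in> pm_interval k \<longleftrightarrow> a \<in> pm_interval k"
  by (simp add: permutes_in_image signed_perms_permutes)

lemma signed_perms_apply_inv [simp]: "w \<in> signed_perms k \<Longrightarrow> w (inv w a) = a"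
  using permutes_inverses(1) signed_perms_permutes by fastforce

lemma signed_perms_inv_apply [simp]: "w \<in> signed_perms k \<Longrightarrow> inv w (w a) = a"
  using permutes_inverses(2) signed_perms_permutes by fastforce

lemma signed_perms_inv:
  assumes "w \<in> signed_perms k"
  shows "inv w \<in> signed_perms k"
proof -
  have "inv w (- a) = - inv w a" for a
    using assms signed_perms_uminus[OF assms, of "inv w a"]
    by (metis signed_perms_apply_inv signed_perms_inv_apply)
  then show ?thesis
    using permutes_inv[OF signed_perms_permutes[OF assms]] by (simp add: signed_perms_def)
qed

lemma signed_perms_eq_iff: "w \<in> signed_perms k \<Longrightarrow> w a = w b \<longleftrightarrow> a = b"
  by (metis signed_perms_inv_apply)

lemma signed_perms_id [simp]: "id \<in> signed_perms k"
  by (simp add: signed_perms_def permutes_id)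

lemma signed_perms_comp:
  assumes "u \<in> signed_perms k" "v \<in> signed_perms k"
  shows "u \<circ> v \<in> signed_perms k"
  using assms
    permutes_compose[OF signed_perms_permutes[OF assms(2)] signed_perms_permutes[OF assms(1)]]
  by (simp add: signed_perms_def[of k] signed_perms_uminus[OF assms(1)])

subsection \<open>Inversion sets and biclosed sets\<close>

definition increasing_pairs :: "nat \<Rightarrow> int rel" where
  "increasing_pairs k = {(a, b). a \<in> pm_interval k \<and> b \<in> pm_interval k \<and> a < b}"

definition inversions :: "nat \<Rightarrow> (int \<Rightarrow> int) \<Rightarrow> int rel" where
  "inversions k w = {(a, b) \<in> increasing_pairs k. inv w b < inv w a}"

definition biclosed :: "nat \<Rightarrow> int rel \<Rightarrow> bool" where
  "biclosed k I \<longleftrightarrow> I \<subseteq> increasing_pairs k \<and> (\<forall>a b. (a, b) \<in> I \<longrightarrow> (- b, - a) \<in> I) \<and>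
     trans I \<and> trans (increasing_pairs k - I)"

lemma increasing_pairs_iff:
  "(a, b) \<in> increasing_pairs k \<longleftrightarrow> a \<in> pm_interval k \<and> b \<in> pm_interval k \<and> a < b"
  by (simp add: increasing_pairs_def)

lemma finite_increasing_pairs [simp]: "finite (increasing_pairs k)"
  by (rule finite_subset[of _ "pm_interval k \<times> pm_interval k"]) (auto simp: increasing_pairs_def)

lemma trans_increasing_pairs: "trans (increasing_pairs k)"
  by (auto simp: trans_def increasing_pairs_iff)

lemma inversions_iff: "(a, b) \<in> inversions k w \<longleftrightarrow> (a, b) \<in> increasing_pairs k \<and> inv w b < inv w a"
  by (simp add: inversions_def)

lemma inversions_subset: "inversions k w \<subseteq> increasing_pairs k"
  by (auto simp: inversions_def)

lemma finite_inversions [simp]: "finite (inversions k w)"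
  by (rule finite_subset[OF inversions_subset]) simp

lemma inversions_id [simp]: "inversions k id = {}"
  by (auto simp: inversions_def increasing_pairs_def)

lemma biclosedI:
  assumes "I \<subseteq> increasing_pairs k"
    and "\<And>a b. (a, b) \<in> I \<Longrightarrow> (- b, - a) \<in> I"
    and "\<And>a b c. (a, b) \<in> I \<Longrightarrow> (b, c) \<in> I \<Longrightarrow> (a, c) \<in> I"
    and "\<And>a b c. (a, c) \<in> I \<Longrightarrow> b \<in> pm_interval k \<Longrightarrow> a < b \<Longrightarrow> b < c \<Longrightarrow> (a, b) \<in> I \<or> (b, c) \<in> I"
  shows "biclosed k I"
  unfolding biclosed_def
proof (intro conjI)
  show "trans (increasing_pairs k - I)"
  proof (rule transI)
    fix a b c assume ab: "(a, b) \<in> increasing_pairs k - I" and bc: "(b, c) \<in> increasing_pairs k - I"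
    then have "b \<in> pm_interval k" "a < b" "b < c" by (simp_all add: increasing_pairs_iff)
    then have "(a, c) \<notin> I" using assms(4)[of a c b] ab bc by blast
    moreover have "(a, c) \<in> increasing_pairs k"
      using ab bc by (simp add: increasing_pairs_iff)
    ultimately show "(a, c) \<in> increasing_pairs k - I" by blast
  qed
  show "trans I" using assms(3) by (rule transI)
  show "\<forall>a b. (a, b) \<in> I \<longrightarrow> (- b, - a) \<in> I" using assms(2) by simp
qed (fact assms(1))

lemma biclosed_subset: "biclosed k I \<Longrightarrow> I \<subseteq> increasing_pairs k"
  by (simp add: biclosed_def)

lemma biclosed_uminus: "biclosed k I \<Longrightarrow> (a, b) \<in> I \<Longrightarrow> (- b, - a) \<in> I"
  by (simp add: biclosed_def)

lemma biclosed_uminus_iff: "biclosed k I \<Longrightarrow> (- b, - a) \<in> I \<longleftrightarrow> (a, b) \<in> I"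
  using biclosed_uminus[of k I a b] biclosed_uminus[of k I "- b" "- a"] by auto

lemma biclosed_trans: "biclosed k I \<Longrightarrow> trans I"
  by (simp add: biclosed_def)

lemma biclosed_cotrans:
  assumes "biclosed k I" "(a, c) \<in> I" "b \<in> pm_interval k" "a < b" "b < c"
  shows "(a, b) \<in> I \<or> (b, c) \<in> I"
proof (rule ccontr)
  assume "\<not> ((a, b) \<in> I \<or> (b, c) \<in> I)"
  then have "(a, b) \<in> increasing_pairs k - I" "(b, c) \<in> increasing_pairs k - I"
    using assms biclosed_subset[of k I] by (auto simp: increasing_pairs_iff)
  then show False using assms(1,2) by (auto simp: biclosed_def dest: transD)
qed

lemma biclosed_inversions: "w \<in> signed_perms k \<Longrightarrow> biclosed k (inversions k w)"
  by (rule biclosedI)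
    (auto simp: inversions_iff increasing_pairs_iff signed_perms_uminus[OF signed_perms_inv])

lemma biclosed_empty: "biclosed k {}"
  using trans_increasing_pairs by (simp add: biclosed_def)

lemma biclosed_complement:
  assumes "biclosed k I"
  shows "biclosed k (increasing_pairs k - I)"
proof -
  have "increasing_pairs k - (increasing_pairs k - I) = I"
    using biclosed_subset[OF assms] by auto
  then show ?thesis
    using assms biclosed_uminus_iff[OF assms] by (auto simp: biclosed_def increasing_pairs_iff)
qed

text \<open>The order in which the values occur in the one-line notation of a signed permutation with
  inversion set \<open>I\<close>.\<close>

definition before :: "int rel \<Rightarrow> int \<Rightarrow> int \<Rightarrow> bool" where
  "before I a b \<longleftrightarrow> a < b \<and> (a, b) \<notin> I \<or> b < a \<and> (b, a) \<in> I"

lemma before_inversions_iff: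
  assumes "w \<in> signed_perms k" "a \<in> pm_interval k" "b \<in> pm_interval k"
  shows "before (inversions k w) a b \<longleftrightarrow> inv w a < inv w b"
  using assms signed_perms_eq_iff[OF signed_perms_inv[OF assms(1)], of a b]
  by (auto simp: before_def inversions_iff increasing_pairs_iff)

lemma transp_on_before:
  assumes I: "biclosed k I"
  shows "transp_on (pm_interval k) (before I)"
proof (rule transp_onI)
  fix a b c assume abc: "a \<in> pm_interval k" "b \<in> pm_interval k" "c \<in> pm_interval k"
    and before: "before I a b" "before I b c"
  then have "a \<noteq> c" by (auto simp: before_def)
  with abc before show "before I a c"
    using transD[OF biclosed_trans[OF I]] biclosed_cotrans[OF I]
    unfolding before_def by (meson linorder_neqE order_less_trans)
qed

lemma inversions_inject:
  assumes u: "u \<in> signed_perms k" and v: "v \<in> signed_perms k"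
    and eq: "inversions k u = inversions k v"
  shows "u = v"
proof -
  have "inv v \<circ> u permutes pm_interval k"
    by (intro permutes_compose permutes_inv signed_perms_permutes u v)
  moreover have "strict_mono_on (pm_interval k) (inv v \<circ> u)"
  proof (rule strict_mono_onI)
    fix i j assume "i \<in> pm_interval k" "j \<in> pm_interval k" "i < j"
    then show "(inv v \<circ> u) i < (inv v \<circ> u) j"
      using u before_inversions_iff[OF u, of "u i" "u j"]
        before_inversions_iff[OF v, of "u i" "u j"]
      by (simp add: eq signed_perms_in_iff[OF u])
  qed
  ultimately have "inv v \<circ> u = id"
    by (intro strict_mono_on_permutes_eq_id[of "pm_interval k"]) auto
  then have "v \<circ> (inv v \<circ> u) = v" by simp
  then show ?thesis using v by (simp add: fun_eq_iff)
qed

lemma biclosed_subset_inversions_if_consecutive: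
  assumes w: "w \<in> signed_perms k" and I: "biclosed k I"
    and consecutive: "\<And>i j. consecutive (pm_interval k) i j \<Longrightarrow> before I (w i) (w j)"
  shows "I \<subseteq> inversions k w"
proof (rule subrelI)
  fix a b assume ab: "(a, b) \<in> I"
  then have inc: "a \<in> pm_interval k" "b \<in> pm_interval k" "a < b"
    using biclosed_subset[OF I] by (auto simp: increasing_pairs_iff)
  have "transp_on (pm_interval k) (\<lambda>i j. before I (w i) (w j))"
    using transp_onD[OF transp_on_before[OF I]] signed_perms_in_iff[OF w]
    by (intro transp_onI) blast
  then have "before I (w i) (w j)" if "i \<in> pm_interval k" "j \<in> pm_interval k" "i < j" for i j
    using transp_on_if_consecutive[OF finite_pm_interval] consecutive that by blast
  from this[of "inv w a" "inv w b"] have "\<not> inv w a < inv w b"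
    using ab inc w by (auto simp: before_def signed_perms_in_iff[OF signed_perms_inv])
  then show "(a, b) \<in> inversions k w"
    using inc signed_perms_eq_iff[OF signed_perms_inv[OF w], of a b]
    by (auto simp: inversions_iff increasing_pairs_iff)
qed

subsection \<open>Simple generators\<close>

text \<open>Multiplying by \<open>s\<close> on the right exchanges the entries at the positions \<open>i\<close> and \<open>j\<close>,
  and those at the positions \<open>- j\<close> and \<open>- i\<close>.\<close>

definition swaps_neighbours :: "nat \<Rightarrow> (int \<Rightarrow> int) \<Rightarrow> int \<Rightarrow> int \<Rightarrow> bool" where
  "swaps_neighbours k s i j \<longleftrightarrow>
     s \<in> signed_perms k \<and> s \<circ> s = id \<and> i \<in> pm_interval k \<and> j \<in> pm_interval k \<and> i < j \<and> s i = j \<and>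
     (\<forall>p\<in>pm_interval k. \<forall>q\<in>pm_interval k. p \<noteq> q \<longrightarrow>
        (s p < s q \<longleftrightarrow> (p < q \<longleftrightarrow> {p, q} \<noteq> {i, j} \<and> {p, q} \<noteq> {- i, - j})))"

lemma swaps_neighboursI:
  assumes s: "s \<in> signed_perms k" "s \<circ> s = id"
    and ij: "i \<in> pm_interval k" "j \<in> pm_interval k" "i < j" "s i = j"
    and less_iff: "\<And>p q. p \<in> pm_interval k \<Longrightarrow> q \<in> pm_interval k \<Longrightarrow> p < q \<Longrightarrow>
      s p < s q \<longleftrightarrow> (p, q) \<noteq> (i, j) \<and> (p, q) \<noteq> (- j, - i)"
  shows "swaps_neighbours k s i j"
  unfolding swaps_neighbours_def
proof (intro conjI ballI impI)
  have doubleton: "{p, q} \<noteq> {i, j} \<and> {p, q} \<noteq> {- i, - j} \<longleftrightarrow>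
      (p, q) \<noteq> (i, j) \<and> (p, q) \<noteq> (- j, - i)"
    if "p < q" for p q
    using that ij(3) by (auto simp: doubleton_eq_iff)
  fix p q assume pq: "p \<in> pm_interval k" "q \<in> pm_interval k" "p \<noteq> q"
  then have "s p \<noteq> s q" using signed_perms_eq_iff[OF s(1)] by simp
  then show "s p < s q \<longleftrightarrow> (p < q \<longleftrightarrow> {p, q} \<noteq> {i, j} \<and> {p, q} \<noteq> {- i, - j})"
    using pq
  proof (cases p q rule: linorder_cases)
    case less
    then show ?thesis using less_iff[of p q] pq doubleton[of p q] by simp
  next
    case greater
    then have "s p < s q \<longleftrightarrow> \<not> s q < s p" using \<open>s p \<noteq> s q\<close> by auto
    then show ?thesis
      using greater less_iff[of q p] pq doubleton[of q p] by (simp add: insert_commute)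
  qed simp
qed fact+

lemma transpose_uminus:
  fixes a b x :: "'a::group_add"
  shows "Transposition.transpose (- a) (- b) (- x) = - Transposition.transpose a b x"
  by (simp add: Transposition.transpose_def)

lemma transpose_commute_if_disjoint:
  assumes "{a, b} \<inter> {c, d} = {}"
  shows "Transposition.transpose a b (Transposition.transpose c d x) =
    Transposition.transpose c d (Transposition.transpose a b x)"
  using assms by (auto simp: Transposition.transpose_def)

lemma transpose_adjacent_less_iff:
  fixes a p q :: int
  assumes "p < q"
  shows "Transposition.transpose a (a + 1) p < Transposition.transpose a (a + 1) q \<longleftrightarrow>
    (p, q) \<noteq> (a, a + 1)"
  using assms by (auto simp: Transposition.transpose_def)

lemma swaps_neighbours_sign_change:
  assumes "k > 0"
  shows "swaps_neighbours k (Transposition.transpose 1 (- 1)) (- 1) 1"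
proof -
  have "Transposition.transpose 1 (- 1) permutes pm_interval k"
    by (rule permutes_swap_id) (use assms in \<open>auto simp: pm_interval_iff\<close>)
  then have "Transposition.transpose 1 (- 1) \<in> signed_perms k"
    by (simp add: signed_perms_def Transposition.transpose_def)
  then show ?thesis using assms
    by (intro swaps_neighboursI) (auto simp: Transposition.transpose_def pm_interval_iff fun_eq_iff)
qed

lemma swaps_neighbours_adjacent_transposition:
  assumes "1 \<le> a" "a < int k"
  shows "swaps_neighbours k
    (Transposition.transpose a (a + 1) \<circ> Transposition.transpose (- a) (- a - 1)) a (a + 1)"
    (is "swaps_neighbours k (?t \<circ> ?t') _ _")
proof (rule swaps_neighboursI)
  have "{a, a + 1} \<inter> {- a, - a - 1} = {}" using assms(1) by auto
  then have commute: "?t (?t' x) = ?t' (?t x)" for x by (rule transpose_commute_if_disjoint)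
  have "?t' (- x) = - ?t x" for x using transpose_uminus[of a "a + 1" x] by simp
  moreover have "?t (- x) = - ?t' x" for x
    using transpose_uminus[of "- a" "- a - 1" x] by (simp add: add.commute)
  ultimately have "(?t \<circ> ?t') (- x) = - (?t \<circ> ?t') x" for x by (simp add: commute)
  moreover have "?t \<circ> ?t' permutes pm_interval k"
    using assms by (intro permutes_compose permutes_swap_id) (auto simp: pm_interval_iff)
  ultimately show "?t \<circ> ?t' \<in> signed_perms k" by (simp add: signed_perms_def)
  show "(?t \<circ> ?t') \<circ> (?t \<circ> ?t') = id" by (simp add: fun_eq_iff commute)
  show "a \<in> pm_interval k" "a + 1 \<in> pm_interval k" "a < a + 1"
    using assms by (simp_all add: pm_interval_iff)
  show "(?t \<circ> ?t') a = a + 1" using assms(1) by (simp add: transpose_apply_other)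
  show "(?t \<circ> ?t') p < (?t \<circ> ?t') q \<longleftrightarrow> (p, q) \<noteq> (a, a + 1) \<and> (p, q) \<noteq> (- (a + 1), - a)"
    if "p < q" for p q
  proof (cases "(p, q) = (- (a + 1), - a)")
    case True
    then show ?thesis using assms(1) by (simp add: Transposition.transpose_def)
  next
    case False
    then have "?t' p < ?t' q"
      using transpose_adjacent_less_iff[OF \<open>p < q\<close>, of "- a - 1"] by (simp add: transpose_commute)
    then have "(?t \<circ> ?t') p < (?t \<circ> ?t') q \<longleftrightarrow> (?t' p, ?t' q) \<noteq> (a, a + 1)"
      by (simp add: transpose_adjacent_less_iff)
    also have "\<dots> \<longleftrightarrow> (p, q) \<noteq> (a, a + 1)"
      using assms(1) by (auto simp: Transposition.transpose_def split: if_splits)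
    finally show ?thesis using False by simp
  qed
qed

lemma swaps_neighbours_uminus:
  assumes "swaps_neighbours k s i j"
  shows "swaps_neighbours k s (- j) (- i)"
proof -
  have s: "s \<in> signed_perms k" "s (s i) = i" "s i = j"
    using assms by (auto simp: swaps_neighbours_def dest: fun_cong[of _ _ i])
  then show ?thesis
    using assms signed_perms_uminus[OF s(1), of j]
    by (simp add: swaps_neighbours_def insert_commute conj_commute)
qed

lemma simple_gens_swaps_neighbours:
  assumes "k > 0" "s \<in> simple_gens k"
  obtains i j where "swaps_neighbours k s i j"
proof -
  consider (sign_change) "s = Transposition.transpose 1 (- 1)"
    | (adjacent) a where "1 \<le> a" "a < int k"
        "s = Transposition.transpose a (a + 1) \<circ> Transposition.transpose (- a) (- a - 1)"
    using assms(2) by (force simp: simple_gens_def)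
  then show thesis
    using that swaps_neighbours_sign_change[OF assms(1)] swaps_neighbours_adjacent_transposition
    by cases blast+
qed

lemma consecutive_swaps_neighbours:
  assumes "k > 0" "consecutive (pm_interval k) i j"
  obtains s where "s \<in> simple_gens k" "swaps_neighbours k s i j"
  using assms(2)
proof (cases rule: consecutive_pm_intervalE)
  case middle
  then show thesis
    using that swaps_neighbours_sign_change[OF assms(1)] by (auto simp: simple_gens_def)
next
  case positive
  then show thesis
    using that[OF _ swaps_neighbours_adjacent_transposition[of i k, folded positive(1)]]
    by (auto simp: simple_gens_def)
next
  case negative
  let ?s = "Transposition.transpose (- j) (- j + 1) \<circ>
    Transposition.transpose (- (- j)) (- (- j) - 1)"
  have j: "1 \<le> - j" "- j < int k" and "i = - (- j + 1)" using negative by auto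
  then have "swaps_neighbours k ?s i j"
    using swaps_neighbours_uminus[OF swaps_neighbours_adjacent_transposition[OF j]] by simp
  moreover have "?s \<in> simple_gens k"
    using j unfolding simple_gens_def by (intro UnI2 CollectI exI[of _ "- j"]) simp
  ultimately show thesis using that by blast
qed

lemma simple_gens_signed_perms: "k > 0 \<Longrightarrow> s \<in> simple_gens k \<Longrightarrow> s \<in> signed_perms k"
  by (erule simple_gens_swaps_neighbours, assumption) (simp add: swaps_neighbours_def)

subsection \<open>The weak order as inclusion of inversion sets\<close>

text \<open>The condition \<open>0 \<le> a + b\<close> selects one element of each orbit of the symmetry
  \<open>(a, b) \<mapsto> (-b, -a)\<close>.\<close>

definition inversion_number :: "nat \<Rightarrow> (int \<Rightarrow> int) \<Rightarrow> nat" where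
  "inversion_number k w = card {(a, b) \<in> inversions k w. 0 \<le> a + b}"

definition ascent_step :: "nat \<Rightarrow> (int \<Rightarrow> int) \<Rightarrow> (int \<Rightarrow> int) \<Rightarrow> bool" where
  "ascent_step k u v \<longleftrightarrow>
     u \<in> signed_perms k \<and> (\<exists>s\<in>simple_gens k. v = u \<circ> s) \<and> inversions k u \<subset> inversions k v"

lemma inversions_comp_swaps_neighbours_iff:
  assumes w: "w \<in> signed_perms k" and s: "swaps_neighbours k s i j"
    and ab: "(a, b) \<in> increasing_pairs k"
  shows "(a, b) \<in> inversions k (w \<circ> s) \<longleftrightarrow>
    ((a, b) \<in> inversions k w \<longleftrightarrow> {a, b} \<noteq> {w i, w j} \<and> {a, b} \<noteq> {- w i, - w j})"
proof -
  have s_in: "s \<in> signed_perms k" and s_involution: "s \<circ> s = id"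
    using s by (simp_all add: swaps_neighbours_def)
  have "inv (w \<circ> s) = inv s \<circ> inv w"
    using permutes_bij[OF signed_perms_permutes[OF w]]
      permutes_bij[OF signed_perms_permutes[OF s_in]] by (rule o_inv_distrib)
  also have "inv s = s" using s_involution by (metis inv_unique_comp)
  finally have inv_comp: "inv (w \<circ> s) = s \<circ> inv w" .
  have pos_in: "inv w a \<in> pm_interval k" "inv w b \<in> pm_interval k"
    using ab by (simp_all add: increasing_pairs_iff signed_perms_in_iff[OF signed_perms_inv[OF w]])
  have pos_neq: "inv w b \<noteq> inv w a"
    using ab signed_perms_eq_iff[OF signed_perms_inv[OF w]] by (simp add: increasing_pairs_iff)
  have pos_eq: "inv w c = p \<longleftrightarrow> c = w p" for c p using w by auto
  have doubleton: "{inv w b, inv w a} = {p, q} \<longleftrightarrow> {a, b} = {w p, w q}" for p q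
    by (auto simp: doubleton_eq_iff pos_eq)
  have "s (inv w b) < s (inv w a) \<longleftrightarrow>
      (inv w b < inv w a \<longleftrightarrow> {inv w b, inv w a} \<noteq> {i, j} \<and> {inv w b, inv w a} \<noteq> {- i, - j})"
    using s pos_in pos_neq by (simp add: swaps_neighbours_def)
  then show ?thesis
    using ab by (simp add: inversions_iff inv_comp doubleton signed_perms_uminus[OF w])
qed

lemma inversions_comp_ascent:
  assumes w: "w \<in> signed_perms k" and s: "swaps_neighbours k s i j" and "w i < w j"
  shows "inversions k (w \<circ> s) = inversions k w \<union> {(w i, w j), (- w j, - w i)}"
    and "(w i, w j) \<notin> inversions k w" and "(- w j, - w i) \<notin> inversions k w"
proof -
  have ij: "i \<in> pm_interval k" "j \<in> pm_interval k" "i < j"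
    using s by (simp_all add: swaps_neighbours_def)
  show notin: "(w i, w j) \<notin> inversions k w" "(- w j, - w i) \<notin> inversions k w"
    using ij w by (simp_all add: inversions_iff signed_perms_uminus[OF signed_perms_inv[OF w]])
  have inc: "(w i, w j) \<in> increasing_pairs k" "(- w j, - w i) \<in> increasing_pairs k"
    using ij \<open>w i < w j\<close> by (simp_all add: increasing_pairs_iff signed_perms_in_iff[OF w])
  have "(a, b) \<in> inversions k (w \<circ> s) \<longleftrightarrow>
      (a, b) \<in> inversions k w \<or> (a, b) = (w i, w j) \<or> (a, b) = (- w j, - w i)"
    if "(a, b) \<in> increasing_pairs k" for a b
    using inversions_comp_swaps_neighbours_iff[OF w s that] that notin \<open>w i < w j\<close>
    by (auto simp: doubleton_eq_iff increasing_pairs_iff)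
  then show "inversions k (w \<circ> s) = inversions k w \<union> {(w i, w j), (- w j, - w i)}"
    using inc inversions_subset[of k w] inversions_subset[of k "w \<circ> s"] by auto
qed

lemma inversion_number_comp_ascent:
  assumes w: "w \<in> signed_perms k" and s: "swaps_neighbours k s i j" and "w i < w j"
  shows "inversion_number k (w \<circ> s) = inversion_number k w + 1"
proof -
  note comp = inversions_comp_ascent[OF assms]
  define p where "p = (if 0 \<le> w i + w j then (w i, w j) else (- w j, - w i))"
  have "{(a, b) \<in> inversions k (w \<circ> s). 0 \<le> a + b} = insert p {(a, b) \<in> inversions k w. 0 \<le> a + b}"
    unfolding comp(1) p_def by auto
  moreover have "p \<notin> inversions k w" using comp(2,3) by (simp add: p_def)
  moreover have "finite {(a, b) \<in> inversions k w. 0 \<le> a + b}"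
    by (rule finite_subset[of _ "inversions k w"]) auto
  ultimately show ?thesis
    unfolding inversion_number_def by (simp add: case_prod_unfold)
qed

definition comp_list :: "('a \<Rightarrow> 'a) list \<Rightarrow> 'a \<Rightarrow> 'a" where
  "comp_list fs = foldr (\<circ>) fs id"

lemma comp_list_Nil: "comp_list [] = id"
  by (simp add: comp_list_def)

lemma comp_list_snoc: "comp_list (fs @ [f]) = comp_list fs \<circ> f"
proof -
  have "foldr (\<circ>) fs f = foldr (\<circ>) fs id \<circ> f" by (induction fs) (simp_all add: comp_assoc)
  then show ?thesis by (simp add: comp_list_def)
qed

lemma inversion_number_id [simp]: "inversion_number k id = 0"
  by (simp add: inversion_number_def)

context
  fixes k :: nat
  assumes k_pos: "k > 0"
begin

lemma simple_gens_ascent_or_descent: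
  assumes w: "w \<in> signed_perms k" and s: "s \<in> simple_gens k"
  obtains (ascent) "ascent_step k w (w \<circ> s)" "inversion_number k (w \<circ> s) = inversion_number k w + 1"
    | (descent) "ascent_step k (w \<circ> s) w" "inversion_number k w = inversion_number k (w \<circ> s) + 1"
proof -
  obtain i j where swaps: "swaps_neighbours k s i j"
    using simple_gens_swaps_neighbours[OF k_pos s] .
  then have s_in: "s \<in> signed_perms k" and s_involution: "s \<circ> s = id" and "s i = j" "i < j"
    by (auto simp: swaps_neighbours_def)
  have step: "ascent_step k u (u \<circ> s)" "inversion_number k (u \<circ> s) = inversion_number k u + 1"
    if "u \<in> signed_perms k" "u i < u j" for u
    using inversions_comp_ascent[OF that(1) swaps that(2)]
      inversion_number_comp_ascent[OF that(1) swaps that(2)] that(1) s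
    by (auto simp: ascent_step_def)
  have "w i \<noteq> w j" using \<open>i < j\<close> signed_perms_eq_iff[OF w] by simp
  moreover have "s j = i" using fun_cong[OF s_involution, of i] \<open>s i = j\<close> by simp
  ultimately consider (less) "w i < w j" | (greater) "(w \<circ> s) i < (w \<circ> s) j"
    using \<open>s i = j\<close> by fastforce
  then show thesis
  proof cases
    case less
    then show thesis using step[OF w] ascent by blast
  next
    case greater
    have "(w \<circ> s) \<circ> s = w" using s_involution by (simp add: comp_assoc)
    then show thesis using step[OF signed_perms_comp[OF w s_in] greater] descent by metis
  qed
qed

lemma inversion_number_ascent_step:
  assumes "ascent_step k u v"
  shows "inversion_number k v = inversion_number k u + 1"
proof -
  obtain s where s: "s \<in> simple_gens k" "v = u \<circ> s" and u: "u \<in> signed_perms k"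
    using assms by (auto simp: ascent_step_def)
  show ?thesis
    using u s(1)
    by (rule simple_gens_ascent_or_descent) (use assms s(2) in \<open>auto simp: ascent_step_def\<close>)
qed

lemma ascent_step_signed_perms:
  "ascent_step k u v \<Longrightarrow> v \<in> signed_perms k"
  using signed_perms_comp simple_gens_signed_perms[OF k_pos] by (auto simp: ascent_step_def)

lemma ascent_step_within_biclosed:
  assumes w: "w \<in> signed_perms k" and I: "biclosed k I" and sub: "inversions k w \<subset> I"
  obtains v where "ascent_step k w v" "inversions k v \<subseteq> I"
proof -
  have "\<not> I \<subseteq> inversions k w" using sub by auto
  then obtain i j where consecutive: "consecutive (pm_interval k) i j"
    and not_before: "\<not> before I (w i) (w j)"
    using biclosed_subset_inversions_if_consecutive[OF w I] by blast
  obtain s where s: "s \<in> simple_gens k" "swaps_neighbours k s i j"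
    using consecutive_swaps_neighbours[OF k_pos consecutive] .
  have ij: "i \<in> pm_interval k" "j \<in> pm_interval k" "i < j"
    using consecutive by (auto simp: consecutive_def)
  have "(w j, w i) \<notin> I" if "w j < w i" using that not_before by (auto simp: before_def)
  moreover have "(w j, w i) \<in> inversions k w" if "w j < w i"
    using that ij w by (simp add: inversions_iff increasing_pairs_iff signed_perms_in_iff)
  moreover have "w i \<noteq> w j" using ij(3) signed_perms_eq_iff[OF w] by simp
  ultimately have "w i < w j" using sub by (meson linorder_neqE psubsetD)
  then have "(w i, w j) \<in> I" using not_before by (auto simp: before_def)
  then have "(- w j, - w i) \<in> I" using biclosed_uminus[OF I] by blast
  with \<open>(w i, w j) \<in> I\<close> inversions_comp_ascent[OF w s(2) \<open>w i < w j\<close>] sub s w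
  have "ascent_step k w (w \<circ> s)" "inversions k (w \<circ> s) \<subseteq> I" by (auto simp: ascent_step_def)
  then show thesis by (rule that)
qed

lemma biclosed_reachable:
  assumes "w \<in> signed_perms k" and I: "biclosed k I" and "inversions k w \<subseteq> I"
  shows "\<exists>v\<in>signed_perms k. inversions k v = I \<and> (ascent_step k)\<^sup>*\<^sup>* w v"
  using assms(1,3)
proof (induction "card (I - inversions k w)" arbitrary: w rule: less_induct)
  case less
  show ?case
  proof (cases "inversions k w = I")
    case True
    then show ?thesis using less.prems by blast
  next
    case False
    then obtain v where v: "ascent_step k w v" "inversions k v \<subseteq> I"
      using ascent_step_within_biclosed[OF less.prems(1) I] less.prems(2) by blast
    have "finite I" using biclosed_subset[OF I] finite_increasing_pairs by (rule finite_subset)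
    moreover have "I - inversions k v \<subset> I - inversions k w"
      using v by (auto simp: ascent_step_def)
    ultimately have "card (I - inversions k v) < card (I - inversions k w)"
      by (intro psubset_card_mono) auto
    then obtain u where "u \<in> signed_perms k" "inversions k u = I" "(ascent_step k)\<^sup>*\<^sup>* v u"
      using less.hyps ascent_step_signed_perms[OF v(1)] v(2) by blast
    then show ?thesis using v(1) by (blast intro: converse_rtranclp_into_rtranclp)
  qed
qed

lemma inversion_number_comp_list_le:
  assumes "set ss \<subseteq> simple_gens k"
  shows "comp_list ss \<in> signed_perms k \<and> inversion_number k (comp_list ss) \<le> length ss"
  using assms
proof (induction ss rule: rev_induct)
  case Nil
  show ?case using signed_perms_id[of k] inversion_number_id[of k] by (metis comp_list_Nil le0)
next
  case (snoc s ss)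
  let ?w = "comp_list ss"
  have s: "s \<in> simple_gens k" and w: "?w \<in> signed_perms k" "inversion_number k ?w \<le> length ss"
    using snoc by auto
  from w(1) s have "inversion_number k (?w \<circ> s) \<le> inversion_number k ?w + 1"
    by (rule simple_gens_ascent_or_descent) simp_all
  then have "inversion_number k (comp_list (ss @ [s])) \<le> length (ss @ [s])"
    using w(2) by (simp add: comp_list_snoc)
  moreover have "comp_list (ss @ [s]) \<in> signed_perms k"
    using signed_perms_comp[OF w(1) simple_gens_signed_perms[OF k_pos s]]
    by (simp add: comp_list_snoc)
  ultimately show ?case by (rule conjI[rotated])
qed

lemma ascent_steps_comp_list:
  assumes "(ascent_step k)\<^sup>*\<^sup>* id w"
  shows "\<exists>ss. length ss = inversion_number k w \<and> set ss \<subseteq> simple_gens k \<and> w = comp_list ss"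
  using assms
proof (induction rule: rtranclp_induct)
  case base
  have "length [] = inversion_number k id \<and> set [] \<subseteq> simple_gens k \<and> id = comp_list []"
    by (simp add: comp_list_Nil)
  then show ?case by (rule exI)
next
  case (step u v)
  then obtain ss
    where ss: "length ss = inversion_number k u" "set ss \<subseteq> simple_gens k" "u = comp_list ss"
    by blast
  obtain s where s: "s \<in> simple_gens k" "v = u \<circ> s"
    using step.hyps(2) by (auto simp: ascent_step_def)
  then have "v = comp_list (ss @ [s])" by (simp only: ss(3) comp_list_snoc)
  then show ?case
    using ss(1,2) s(1) inversion_number_ascent_step[OF step.hyps(2)]
    by (intro exI[of _ "ss @ [s]"]) simp
qed

lemma length_B_eq_inversion_number:
  assumes w: "w \<in> signed_perms k"
  shows "length_B k w = inversion_number k w"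
  unfolding length_B_def comp_list_def[symmetric]
proof (rule Least_equality)
  obtain v where "v \<in> signed_perms k" "inversions k v = inversions k w" "(ascent_step k)\<^sup>*\<^sup>* id v"
    using biclosed_reachable[OF signed_perms_id biclosed_inversions[OF w]] by auto
  then have "(ascent_step k)\<^sup>*\<^sup>* id w" using inversions_inject w by metis
  then show "\<exists>ss. length ss = inversion_number k w \<and> set ss \<subseteq> simple_gens k \<and> w = comp_list ss"
    by (rule ascent_steps_comp_list)
next
  fix r assume "\<exists>ss. length ss = r \<and> set ss \<subseteq> simple_gens k \<and> w = comp_list ss"
  then show "inversion_number k w \<le> r" using inversion_number_comp_list_le by blast
qed

lemma weak_cover_eq_ascent_step: "weak_cover k = ascent_step k"
proof (intro ext iffI)
  fix u v assume "weak_cover k u v"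
  then obtain s where u: "u \<in> signed_perms k" and s: "s \<in> simple_gens k" "v = u \<circ> s"
    and length: "length_B k (u \<circ> s) = length_B k u + 1"
    by (auto simp: weak_cover_def)
  have "u \<circ> s \<in> signed_perms k"
    using signed_perms_comp[OF u simple_gens_signed_perms[OF k_pos s(1)]] .
  then have "inversion_number k (u \<circ> s) = inversion_number k u + 1"
    using length u by (simp add: length_B_eq_inversion_number)
  with u s(1) have "ascent_step k u (u \<circ> s)" by (auto elim: simple_gens_ascent_or_descent)
  then show "ascent_step k u v" using s(2) by simp
next
  fix u v assume uv: "ascent_step k u v"
  then have "length_B k v = length_B k u + 1"
    using inversion_number_ascent_step ascent_step_signed_perms
    by (simp add: length_B_eq_inversion_number ascent_step_def)
  then show "weak_cover k u v" using uv by (auto simp: weak_cover_def ascent_step_def)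
qed

lemma weak_le_iff_inversions_subset:
  assumes u: "u \<in> signed_perms k" and v: "v \<in> signed_perms k"
  shows "weak_le k u v \<longleftrightarrow> inversions k u \<subseteq> inversions k v"
proof
  assume "weak_le k u v"
  then show "inversions k u \<subseteq> inversions k v"
    unfolding weak_le_def weak_cover_eq_ascent_step by induction (auto simp: ascent_step_def)
next
  assume "inversions k u \<subseteq> inversions k v"
  then obtain v'
    where "v' \<in> signed_perms k" "inversions k v' = inversions k v" "(ascent_step k)\<^sup>*\<^sup>* u v'"
    using biclosed_reachable[OF u biclosed_inversions[OF v]] by blast
  then show "weak_le k u v"
    unfolding weak_le_def weak_cover_eq_ascent_step using inversions_inject[OF _ v] by metis
qed

lemma inversions_image_signed_perms: "inversions k ` signed_perms k = {I. biclosed k I}"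
  using biclosed_inversions biclosed_reachable[OF signed_perms_id] by (fastforce simp: image_iff)

lemma partial_order_weak_le:
  assumes "C \<subseteq> signed_perms k"
  shows "partial_order \<lparr>carrier = C, eq = (=), le = weak_le k\<rparr>"
proof (rule partial_orderI)
  show "antisymp_on C (weak_le k)"
  proof (rule antisymp_onI)
    fix u v assume "u \<in> C" "v \<in> C" and le: "weak_le k u v" "weak_le k v u"
    then have uv: "u \<in> signed_perms k" "v \<in> signed_perms k" using assms by auto
    then have "inversions k u = inversions k v"
      using le by (intro equalityI) (simp_all add: weak_le_iff_inversions_subset)
    then show "u = v" by (rule inversions_inject[OF uv])
  qed
qed (auto simp: weak_le_def intro: reflp_onI transp_onI)

end

lemma partial_order_B_poset: "k > 0 \<Longrightarrow> partial_order (B_poset k)"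
  by (simp add: B_poset_def partial_order_weak_le)

subsection \<open>The lattice of biclosed sets\<close>

definition biclosed_poset :: "nat \<Rightarrow> int rel gorder" where
  "biclosed_poset k = inclusion_poset {I. biclosed k I}"

lemma partial_order_biclosed_poset: "partial_order (biclosed_poset k)"
  unfolding biclosed_poset_def by (rule partial_order_inclusion_poset)

lemma B_poset_isomorphic_biclosed_poset:
  assumes "k > 0"
  shows "poset_isomorphic (B_poset k) (biclosed_poset k)"
proof (rule poset_isomorphicI)
  show "partial_order (B_poset k)" using assms by (rule partial_order_B_poset)
  show "partial_order (biclosed_poset k)" by (rule partial_order_biclosed_poset)
  show "inversions k ` carrier (B_poset k) = carrier (biclosed_poset k)"
    using inversions_image_signed_perms[OF assms] by (simp add: B_poset_def biclosed_poset_def)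
qed (use assms in \<open>simp add: B_poset_def biclosed_poset_def weak_le_iff_inversions_subset\<close>)

lemma trancl_cotrans:
  fixes R :: "'a::linorder rel"
  assumes cotrans: "\<And>x y. (x, y) \<in> R \<Longrightarrow> x < b \<Longrightarrow> b < y \<Longrightarrow> (x, b) \<in> R \<or> (b, y) \<in> R"
    and "(a, c) \<in> R\<^sup>+" "a < b" "b < c"
  shows "(a, b) \<in> R\<^sup>+ \<or> (b, c) \<in> R\<^sup>+"
  using assms(2,4)
proof (induction rule: trancl_induct)
  case (base c)
  then show ?case using cotrans \<open>a < b\<close> by blast
next
  case (step y c)
  consider (less) "b < y" | (equal) "b = y" | (greater) "y < b" by (rule linorder_cases)
  then show ?case
  proof cases
    case less
    then show ?thesis using step by (meson trancl_into_trancl)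
  next
    case equal
    then show ?thesis using step by blast
  next
    case greater
    then show ?thesis using cotrans[OF step.hyps(2) greater step.prems] step.hyps(1)
      by (meson trancl_into_trancl r_into_trancl)
  qed
qed

lemma trancl_subset_if_trans: "R \<subseteq> S \<Longrightarrow> trans S \<Longrightarrow> R\<^sup>+ \<subseteq> S"
  using trancl_mono_subset[of R S] by (simp add: trancl_id)

lemma biclosed_trancl_Un:
  assumes I: "biclosed k I" and J: "biclosed k J"
  shows "biclosed k ((I \<union> J)\<^sup>+)"
proof (rule biclosedI)
  show "(I \<union> J)\<^sup>+ \<subseteq> increasing_pairs k"
    using biclosed_subset[OF I] biclosed_subset[OF J] trans_increasing_pairs
    by (intro trancl_subset_if_trans) auto
next
  fix a b assume "(a, b) \<in> (I \<union> J)\<^sup>+"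
  then show "(- b, - a) \<in> (I \<union> J)\<^sup>+"
  proof induction
    case (base b)
    then show ?case using biclosed_uminus[OF I] biclosed_uminus[OF J] by blast
  next
    case (step b c)
    then have "(- c, - b) \<in> I \<union> J" using biclosed_uminus[OF I] biclosed_uminus[OF J] by blast
    then show ?case using step by (meson trancl_into_trancl2)
  qed
next
  fix a b c assume "(a, c) \<in> (I \<union> J)\<^sup>+" "b \<in> pm_interval k" "a < b" "b < c"
  then show "(a, b) \<in> (I \<union> J)\<^sup>+ \<or> (b, c) \<in> (I \<union> J)\<^sup>+"
    using biclosed_cotrans[OF I] biclosed_cotrans[OF J]
    by (intro trancl_cotrans[where R = "I \<union> J"]) blast+
qed (rule trancl_trans)

lemma complemented_bounded_lattice_biclosed_poset: "complemented_bounded_lattice (biclosed_poset k)"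
  unfolding biclosed_poset_def
proof (rule complemented_bounded_lattice_inclusion_poset[where U = "increasing_pairs k"])
  fix I J assume "I \<in> {I. biclosed k I}" "J \<in> {I. biclosed k I}"
  then have "(I \<union> J)\<^sup>+ \<in> {I. biclosed k I}" by (simp add: biclosed_trancl_Un)
  then show "\<exists>K\<in>{I. biclosed k I}. I \<union> J \<subseteq> K \<and> (\<forall>L\<in>{I. biclosed k I}. I \<union> J \<subseteq> L \<longrightarrow> K \<subseteq> L)"
    using trancl_subset_if_trans[OF _ biclosed_trans] by (intro bexI[of _ "(I \<union> J)\<^sup>+"]) auto
qed (use biclosed_subset biclosed_empty biclosed_complement in auto)

subsection \<open>Blocks\<close>

definition block :: "int \<Rightarrow> int" where
  "block a = sgn a * ((\<bar>a\<bar> + 1) div 2)"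

text \<open>The odd element is the representative because for odd \<open>n\<close> the last block is \<open>{n}\<close>.\<close>

definition block_rep :: "int \<Rightarrow> int" where
  "block_rep c = 2 * c - sgn c"

lemma block_uminus: "block (- a) = - block a"
  by (simp add: block_def)

lemma block_rep_uminus: "block_rep (- c) = - block_rep c"
  by (simp add: block_rep_def)

lemma block_eq_iff:
  assumes "c \<noteq> 0"
  shows "block a = c \<longleftrightarrow> a = block_rep c \<or> a = 2 * c"
  using assms by (auto simp: block_def block_rep_def sgn_if split: if_splits)

lemma block_eq_0_iff [simp]: "block a = 0 \<longleftrightarrow> a = 0"
  by (auto simp: block_def sgn_if div_eq_0_iff)

lemma block_block_rep: "c \<noteq> 0 \<Longrightarrow> block (block_rep c) = c"
  by (simp add: block_eq_iff)

lemma mono_block: "mono block"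
  by (rule monoI) (auto simp: block_def sgn_if zdiv_mono1)

lemma block_less_iff: "block a \<noteq> block b \<Longrightarrow> block a < block b \<longleftrightarrow> a < b"
  using monoD[OF mono_block, of a b] monoD[OF mono_block, of b a] by linarith

lemma block_rep_less_iff: "c \<noteq> 0 \<Longrightarrow> d \<noteq> 0 \<Longrightarrow> block_rep c < block_rep d \<longleftrightarrow> c < d"
  by (auto simp: block_rep_def sgn_if)

lemma block_in_pm_interval:
  "a \<in> pm_interval n \<Longrightarrow> block a \<in> pm_interval ((n + 1) div 2)"
  by (auto simp: pm_interval_iff block_def sgn_if abs_mult)

lemma block_rep_in_pm_interval:
  "c \<in> pm_interval ((n + 1) div 2) \<Longrightarrow> block_rep c \<in> pm_interval n"
  by (auto simp: pm_interval_iff block_rep_def sgn_if)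

lemma block_eq_cases:
  assumes "block a = block b" "a < b" "a \<in> pm_interval n" "b \<in> pm_interval n"
  obtains i where "i \<in> {1..n div 2}" "int i = \<bar>block a\<bar>"
    "a = 2 * int i - 1 \<and> b = 2 * int i \<or> a = - (2 * int i) \<and> b = - (2 * int i - 1)"
proof -
  have "block a \<noteq> 0" using assms(3) by (simp add: pm_interval_iff)
  then have "a = block_rep (block a) \<or> a = 2 * block a" "b = block_rep (block a) \<or> b = 2 * block a"
    using block_eq_iff[of "block a" a] block_eq_iff[of "block a" b] assms(1) by simp_all
  then have "0 < block a \<and> a = 2 * block a - 1 \<and> b = 2 * block a \<or>
      block a < 0 \<and> a = 2 * block a \<and> b = 2 * block a + 1"
    using \<open>a < b\<close> \<open>block a \<noteq> 0\<close> by (auto simp: block_rep_def sgn_if split: if_splits)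
  then show thesis
    using assms(3,4) by (intro that[of "nat \<bar>block a\<bar>"]) (auto simp: pm_interval_iff)
qed

lemma block_at_most_two:
  assumes "block a = block b" "a \<noteq> b" "a \<noteq> 0" "b \<noteq> 0" "block c = block a"
  shows "c = a \<or> c = b"
  using assms block_eq_iff[of "block a"] by (metis block_eq_0_iff)

subsection \<open>Signed Wachs permutations\<close>

lemma signed_wachs_iff_pairs:
  "v \<in> signed_wachs n \<longleftrightarrow>
     v \<in> signed_perms n \<and> (\<forall>i\<in>{1..n div 2}. \<bar>inv v (2 * int i - 1) - inv v (2 * int i)\<bar> \<le> 1)"
proof -
  have "(\<forall>a\<in>{1..n - 1}. \<bar>inv v (int a) - inv v (int (star n a))\<bar> \<le> 1) \<longleftrightarrow>
      (\<forall>i\<in>{1..n div 2}. \<bar>inv v (2 * int i - 1) - inv v (2 * int i)\<bar> \<le> 1)" (is "?star \<longleftrightarrow> ?pairs")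
  proof
    assume star: ?star
    show ?pairs
    proof
      fix i assume i: "i \<in> {1..n div 2}"
      then have "2 * i - 1 \<in> {1..n - 1}" "star n (2 * i - 1) = 2 * i" by (auto simp: star_def)
      then have "\<bar>inv v (int (2 * i - 1)) - inv v (int (2 * i))\<bar> \<le> 1" using star by metis
      then show "\<bar>inv v (2 * int i - 1) - inv v (2 * int i)\<bar> \<le> 1" using i by (simp add: of_nat_diff)
    qed
  next
    assume pairs: ?pairs
    show ?star
    proof
      fix a assume a: "a \<in> {1..n - 1}"
      show "\<bar>inv v (int a) - inv v (int (star n a))\<bar> \<le> 1"
      proof (cases "even a")
        case True
        then obtain i where "a = 2 * i" by blast
        then show ?thesis
          using a pairs[rule_format, of i] by (auto simp: star_def of_nat_diff abs_minus_commute)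
      next
        case False
        then obtain i where "a = 2 * i + 1" using oddE by blast
        then show ?thesis
          using a pairs[rule_format, of "i + 1"] by (auto simp: star_def add.commute)
      qed
    qed
  qed
  then show ?thesis by (simp add: signed_wachs_def)
qed

lemma signed_wachs_signed_perms: "v \<in> signed_wachs n \<Longrightarrow> v \<in> signed_perms n"
  by (simp add: signed_wachs_def)

lemma signed_wachs_iff_close:
  assumes v: "v \<in> signed_perms n"
  shows "v \<in> signed_wachs n \<longleftrightarrow>
    (\<forall>a\<in>pm_interval n. \<forall>b\<in>pm_interval n. block a = block b \<longrightarrow> \<bar>inv v a - inv v b\<bar> \<le> 1)"
    (is "_ \<longleftrightarrow> ?close")
proof
  assume wachs: "v \<in> signed_wachs n"
  have less: "\<bar>inv v a - inv v b\<bar> \<le> 1"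
    if ab: "block a = block b" "a < b" "a \<in> pm_interval n" "b \<in> pm_interval n" for a b
  proof -
    obtain i where i: "i \<in> {1..n div 2}"
      and ab_eq: "a = 2 * int i - 1 \<and> b = 2 * int i \<or> a = - (2 * int i) \<and> b = - (2 * int i - 1)"
      using ab by (rule block_eq_cases)
    have "\<bar>inv v (2 * int i - 1) - inv v (2 * int i)\<bar> \<le> 1"
      using wachs i by (simp add: signed_wachs_iff_pairs)
    with ab_eq show ?thesis
      by (elim disjE conjE)
        (simp_all only: signed_perms_uminus[OF signed_perms_inv[OF v]] minus_diff_minus
          abs_minus_cancel abs_minus_commute)
  qed
  have "\<bar>inv v a - inv v b\<bar> \<le> 1"
    if "a \<in> pm_interval n" "b \<in> pm_interval n" "block a = block b" for a b
    using less[of a b] less[of b a] that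
    by (cases a b rule: linorder_cases) (auto simp: abs_minus_commute)
  then show ?close by blast
next
  assume close: ?close
  have "\<bar>inv v (2 * int i - 1) - inv v (2 * int i)\<bar> \<le> 1" if "i \<in> {1..n div 2}" for i
  proof -
    have "2 * int i - 1 \<in> pm_interval n" "2 * int i \<in> pm_interval n"
      using that by (auto simp: pm_interval_iff)
    moreover have "block (2 * int i - 1) = int i" "block (2 * int i) = int i"
      using that by (simp_all add: block_eq_iff block_rep_def)
    ultimately show ?thesis using close by simp
  qed
  then show "v \<in> signed_wachs n" using v by (simp add: signed_wachs_iff_pairs)
qed

text \<open>The hypothesis \<open>a \<noteq> - b\<close> excludes the neighbouring positions \<open>-1\<close> and \<open>1\<close>, which are at
  distance 2.\<close>

lemma signed_perms_next_position:
  assumes v: "v \<in> signed_perms n" and ab: "a \<in> pm_interval n" "b \<in> pm_interval n" "a \<noteq> - b"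
    and less: "inv v a < inv v b"
    and same_side: "\<forall>c\<in>pm_interval n - {a, b}. inv v a < inv v c \<longleftrightarrow> inv v b < inv v c"
  shows "inv v b = inv v a + 1"
proof -
  have "inv v a \<noteq> inv v (- b)"
    using ab(3) signed_perms_eq_iff[OF signed_perms_inv[OF v]] by simp
  then have not_opposite: "inv v a \<noteq> - inv v b"
    by (simp add: signed_perms_uminus[OF signed_perms_inv[OF v]])
  have "\<not> (inv v a < p \<and> p < inv v b)" if "p \<in> pm_interval n" for p
  proof -
    have "inv v (v p) = p" "v p \<in> pm_interval n" using v that by (simp_all add: signed_perms_in_iff)
    then show ?thesis using same_side[rule_format, of "v p"] by (cases "v p \<in> {a, b}") auto
  qed
  then have "consecutive (pm_interval n) (inv v a) (inv v b)"
    using ab less by (auto simp: consecutive_def signed_perms_in_iff[OF signed_perms_inv[OF v]])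
  then show ?thesis
    by (cases rule: consecutive_pm_intervalE) (use not_opposite in auto)
qed

lemma signed_perms_close_iff:
  assumes v: "v \<in> signed_perms n" and ab: "a \<in> pm_interval n" "b \<in> pm_interval n" "a \<noteq> b" "a \<noteq> - b"
  shows "\<bar>inv v a - inv v b\<bar> \<le> 1 \<longleftrightarrow>
    (\<forall>c\<in>pm_interval n - {a, b}. inv v a < inv v c \<longleftrightarrow> inv v b < inv v c)" (is "_ \<longleftrightarrow> ?same_side")
proof -
  have pos_neq: "inv v x \<noteq> inv v y" if "x \<noteq> y" for x y
    using that signed_perms_eq_iff[OF signed_perms_inv[OF v]] by simp
  show ?thesis
  proof
    assume close: "\<bar>inv v a - inv v b\<bar> \<le> 1"
    have "inv v a < inv v c \<longleftrightarrow> inv v b < inv v c" if "c \<notin> {a, b}" for c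
      using close pos_neq[of a c] pos_neq[of b c] that by auto
    then show ?same_side by blast
  next
    assume same_side: ?same_side
    then have "\<forall>c\<in>pm_interval n - {b, a}. inv v b < inv v c \<longleftrightarrow> inv v a < inv v c" by blast
    then show "\<bar>inv v a - inv v b\<bar> \<le> 1"
      using signed_perms_next_position[OF v ab(1,2,4) _ same_side]
        signed_perms_next_position[OF v ab(2,1)] pos_neq[OF ab(3)] ab(4)
      by (cases "inv v a" "inv v b" rule: linorder_cases) auto
  qed
qed

lemma signed_wachs_iff_blocks:
  assumes v: "v \<in> signed_perms n"
  shows "v \<in> signed_wachs n \<longleftrightarrow>
    (\<forall>a\<in>pm_interval n. \<forall>b\<in>pm_interval n. \<forall>c\<in>pm_interval n.
       block a = block b \<longrightarrow> block c \<noteq> block a \<longrightarrow> (inv v a < inv v c \<longleftrightarrow> inv v b < inv v c))"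
proof -
  have "\<bar>inv v a - inv v b\<bar> \<le> 1 \<longleftrightarrow>
      (\<forall>c\<in>pm_interval n. block c \<noteq> block a \<longrightarrow> (inv v a < inv v c \<longleftrightarrow> inv v b < inv v c))"
    if ab: "a \<in> pm_interval n" "b \<in> pm_interval n" "block a = block b" for a b
  proof (cases "a = b")
    case False
    have nonzero: "a \<noteq> 0" "b \<noteq> 0" using ab by (simp_all add: pm_interval_iff)
    then have "a \<noteq> - b" using ab(3) by (auto simp: block_uminus)
    moreover have "c \<notin> {a, b} \<longleftrightarrow> block c \<noteq> block a" for c
      using block_at_most_two[OF ab(3) False nonzero(1,2), of c] ab(3) by auto
    ultimately show ?thesis
      using signed_perms_close_iff[OF v ab(1,2) False] by auto
  qed simp
  then show ?thesis unfolding signed_wachs_iff_close[OF v] by blast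
qed

subsection \<open>Decomposition of signed Wachs permutations\<close>

definition block_pairs :: "nat \<Rightarrow> int rel \<Rightarrow> int rel" where
  "block_pairs n I = {(c, d) \<in> increasing_pairs ((n + 1) div 2). (block_rep c, block_rep d) \<in> I}"

definition flipped_blocks :: "nat \<Rightarrow> int rel \<Rightarrow> nat set" where
  "flipped_blocks n I = {i \<in> {1..n div 2}. (2 * int i - 1, 2 * int i) \<in> I}"

definition inflate :: "nat \<Rightarrow> int rel \<Rightarrow> nat set \<Rightarrow> int rel" where
  "inflate n J X = {(a, b) \<in> increasing_pairs n.
     if block a = block b then nat \<bar>block a\<bar> \<in> X else (block a, block b) \<in> J}"

lemma biclosed_pullback:
  assumes I: "biclosed n I" and image: "\<And>c. c \<in> pm_interval m \<Longrightarrow> f c \<in> pm_interval n"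
    and uminus: "\<And>c. f (- c) = - f c"
    and mono: "\<And>c d. c \<in> pm_interval m \<Longrightarrow> d \<in> pm_interval m \<Longrightarrow> c < d \<Longrightarrow> f c < f d"
  shows "biclosed m {(c, d) \<in> increasing_pairs m. (f c, f d) \<in> I}" (is "biclosed m ?J")
proof (rule biclosedI)
  fix a b c assume "(a, b) \<in> ?J" "(b, c) \<in> ?J"
  then show "(a, c) \<in> ?J"
    using transD[OF biclosed_trans[OF I]] transD[OF trans_increasing_pairs] by blast
next
  fix a b c assume "(a, c) \<in> ?J" "b \<in> pm_interval m" "a < b" "b < c"
  then show "(a, b) \<in> ?J \<or> (b, c) \<in> ?J"
    using biclosed_cotrans[OF I, of "f a" "f c" "f b"] image mono
    by (auto simp: increasing_pairs_iff)
qed (auto simp: increasing_pairs_iff uminus biclosed_uminus_iff[OF I])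

lemma biclosed_block_pairs: "biclosed n I \<Longrightarrow> biclosed ((n + 1) div 2) (block_pairs n I)"
  unfolding block_pairs_def
  by (rule biclosed_pullback[where f = block_rep, OF _ block_rep_in_pm_interval block_rep_uminus])
    (assumption | simp add: block_rep_less_iff pm_interval_iff)+

lemma inflate_subset: "inflate n J X \<subseteq> increasing_pairs n"
  by (auto simp: inflate_def)

lemma inflate_mono: "J \<subseteq> J' \<Longrightarrow> X \<subseteq> X' \<Longrightarrow> inflate n J X \<subseteq> inflate n J' X'"
  by (auto simp: inflate_def)

lemma block_less_if_between:
  assumes "a < b" "b < c" "a \<in> pm_interval n" "b \<in> pm_interval n" "c \<in> pm_interval n"
  shows "block a < block c"
proof -
  have "block a \<noteq> block c"
    using assms block_at_most_two[of a c b] monoD[OF mono_block, of a b]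
      monoD[OF mono_block, of b c]
    by (auto simp: pm_interval_iff)
  then show ?thesis using block_less_iff assms(1,2) by simp
qed

lemma biclosed_inflate:
  assumes J: "biclosed ((n + 1) div 2) J"
  shows "biclosed n (inflate n J X)"
proof (rule biclosedI)
  show "inflate n J X \<subseteq> increasing_pairs n" by (rule inflate_subset)
next
  fix a b assume "(a, b) \<in> inflate n J X"
  then show "(- b, - a) \<in> inflate n J X"
    by (auto simp: inflate_def increasing_pairs_iff block_uminus biclosed_uminus_iff[OF J]
        split: if_splits)
next
  fix a b c assume ab: "(a, b) \<in> inflate n J X" and bc: "(b, c) \<in> inflate n J X"
  then have "block a < block c"
    using block_less_if_between[of a b c n] by (auto simp: inflate_def increasing_pairs_iff)
  then show "(a, c) \<in> inflate n J X"
    using ab bc transD[OF biclosed_trans[OF J], of "block a" "block b" "block c"]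
    by (auto simp: inflate_def increasing_pairs_iff split: if_splits)
next
  fix a b c assume ac: "(a, c) \<in> inflate n J X" and b: "b \<in> pm_interval n" "a < b" "b < c"
  then have "block a < block c"
    using block_less_if_between[of a b c n] by (auto simp: inflate_def increasing_pairs_iff)
  moreover have "block a \<le> block b" "block b \<le> block c"
    using b by (simp_all add: monoD[OF mono_block])
  ultimately show "(a, b) \<in> inflate n J X \<or> (b, c) \<in> inflate n J X"
    using ac b block_in_pm_interval[OF b(1)]
      biclosed_cotrans[OF J, of "block a" "block c" "block b"]
    by (auto simp: inflate_def increasing_pairs_iff split: if_splits)
qed

lemma block_pairs_inflate:
  assumes "J \<subseteq> increasing_pairs ((n + 1) div 2)"
  shows "block_pairs n (inflate n J X) = J"
proof -
  have "(block_rep c, block_rep d) \<in> inflate n J X \<longleftrightarrow> (c, d) \<in> J"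
    if "(c, d) \<in> increasing_pairs ((n + 1) div 2)" for c d
  proof -
    have "c \<noteq> 0" "d \<noteq> 0" using that by (auto simp: increasing_pairs_iff pm_interval_iff)
    then show ?thesis using that block_rep_in_pm_interval[of _ n]
      by (auto simp: inflate_def increasing_pairs_iff block_block_rep block_rep_less_iff)
  qed
  then show ?thesis using assms by (auto simp: block_pairs_def)
qed

lemma flipped_blocks_inflate:
  assumes "X \<subseteq> {1..n div 2}"
  shows "flipped_blocks n (inflate n J X) = X"
proof -
  have "(2 * int i - 1, 2 * int i) \<in> inflate n J X \<longleftrightarrow> i \<in> X" if "i \<in> {1..n div 2}" for i
  proof -
    have "block (2 * int i - 1) = int i" "block (2 * int i) = int i"
      using that by (simp_all add: block_eq_iff block_rep_def)
    then show ?thesis using that by (auto simp: inflate_def increasing_pairs_iff pm_interval_iff)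
  qed
  then show ?thesis using assms by (auto simp: flipped_blocks_def)
qed

lemma biclosed_same_block_iff:
  assumes I: "biclosed n I" and ab: "(a, b) \<in> increasing_pairs n" "block a = block b"
  shows "(a, b) \<in> I \<longleftrightarrow> nat \<bar>block a\<bar> \<in> flipped_blocks n I"
proof -
  have "a < b" "a \<in> pm_interval n" "b \<in> pm_interval n"
    using ab(1) by (simp_all add: increasing_pairs_iff)
  with ab(2) obtain i where i: "i \<in> {1..n div 2}" "int i = \<bar>block a\<bar>"
    and "a = 2 * int i - 1 \<and> b = 2 * int i \<or> a = - (2 * int i) \<and> b = - (2 * int i - 1)"
    by (rule block_eq_cases)
  then have "(a, b) \<in> I \<longleftrightarrow> (2 * int i - 1, 2 * int i) \<in> I"
    using biclosed_uminus_iff[OF I, of "2 * int i" "2 * int i - 1"] by auto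
  moreover have "nat \<bar>block a\<bar> = i" using i(2) by simp
  ultimately show ?thesis using i(1) by (simp add: flipped_blocks_def)
qed

lemma signed_wachs_inverted_blocks:
  assumes wachs: "v \<in> signed_wachs n"
    and "a \<in> pm_interval n" "a' \<in> pm_interval n" "b \<in> pm_interval n" "b' \<in> pm_interval n"
    and "block a = block a'" "block b = block b'" "block a \<noteq> block b"
  shows "inv v b < inv v a \<longleftrightarrow> inv v b' < inv v a'"
proof -
  have v: "v \<in> signed_perms n" using wachs by (rule signed_wachs_signed_perms)
  have same_side: "inv v x < inv v z \<longleftrightarrow> inv v y < inv v z"
    if "x \<in> pm_interval n" "y \<in> pm_interval n" "z \<in> pm_interval n"
      "block x = block y" "block z \<noteq> block x" for x y z
    using wachs that unfolding signed_wachs_iff_blocks[OF v] by blast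
  have pos_neq: "inv v x \<noteq> inv v y" if "block x \<noteq> block y" for x y
    using that signed_perms_eq_iff[OF signed_perms_inv[OF v]] by auto
  have "inv v b < inv v a \<longleftrightarrow> inv v b' < inv v a"
    using same_side[of b b' a] assms by simp
  also have "\<dots> \<longleftrightarrow> \<not> inv v a < inv v b'"
    using pos_neq[of a b'] assms(7,8) by auto
  also have "\<dots> \<longleftrightarrow> \<not> inv v a' < inv v b'"
    using same_side[of a a' b'] assms by simp
  also have "\<dots> \<longleftrightarrow> inv v b' < inv v a'"
    using pos_neq[of a' b'] assms(6-8) by auto
  finally show ?thesis .
qed

lemma signed_wachs_inversions_eq_inflate:
  assumes wachs: "v \<in> signed_wachs n"
  shows "inversions n v =
    inflate n (block_pairs n (inversions n v)) (flipped_blocks n (inversions n v))" (is "?I = ?K")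
proof -
  have I: "biclosed n ?I"
    using biclosed_inversions[OF signed_wachs_signed_perms[OF wachs]] .
  have "(a, b) \<in> ?I \<longleftrightarrow> (a, b) \<in> ?K" if inc: "(a, b) \<in> increasing_pairs n" for a b
  proof (cases "block a = block b")
    case True
    then show ?thesis using inc biclosed_same_block_iff[OF I inc] by (simp add: inflate_def)
  next
    case False
    let ?a' = "block_rep (block a)" and ?b' = "block_rep (block b)"
    have ab: "a \<in> pm_interval n" "b \<in> pm_interval n" "a < b"
      using inc by (simp_all add: increasing_pairs_iff)
    then have blocks: "(block a, block b) \<in> increasing_pairs ((n + 1) div 2)"
      using False block_less_iff block_in_pm_interval[OF ab(1)] block_in_pm_interval[OF ab(2)]
      by (simp add: increasing_pairs_iff)
    then have "block a \<noteq> 0" "block b \<noteq> 0" by (auto simp: increasing_pairs_iff pm_interval_iff)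
    then have reps: "(?a', ?b') \<in> increasing_pairs n" "block ?a' = block a" "block ?b' = block b"
      using blocks
      by (simp_all add: increasing_pairs_iff block_rep_in_pm_interval block_rep_less_iff
          block_block_rep)
    have "(a, b) \<in> ?I \<longleftrightarrow> (?a', ?b') \<in> ?I"
      using signed_wachs_inverted_blocks[OF wachs, of a ?a' b ?b'] ab inc reps False
      by (simp add: inversions_iff increasing_pairs_iff)
    then show ?thesis using inc blocks False by (simp add: inflate_def block_pairs_def)
  qed
  then show ?thesis using inversions_subset[of n v] inflate_subset by fast
qed

lemma signed_wachs_if_inversions_eq_inflate:
  assumes v: "v \<in> signed_perms n" and eq: "inversions n v = inflate n J X"
  shows "v \<in> signed_wachs n"
  unfolding signed_wachs_iff_blocks[OF v]
proof (intro ballI impI)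
  fix a b c assume abc: "a \<in> pm_interval n" "b \<in> pm_interval n" "c \<in> pm_interval n"
    and blocks: "block a = block b" "block c \<noteq> block a"
  have "before (inflate n J X) a c \<longleftrightarrow> before (inflate n J X) b c"
    using abc blocks block_less_iff[of a c] block_less_iff[of b c]
      block_less_iff[of c a] block_less_iff[of c b]
    by (auto simp: before_def inflate_def increasing_pairs_iff)
  then show "inv v a < inv v c \<longleftrightarrow> inv v b < inv v c"
    using before_inversions_iff[OF v] abc eq by simp
qed

definition wachs_decomposition :: "nat \<Rightarrow> (int \<Rightarrow> int) \<Rightarrow> int rel \<times> nat set" where
  "wachs_decomposition n v = (block_pairs n (inversions n v), flipped_blocks n (inversions n v))"

lemma wachs_decomposition_image:
  assumes "n > 0"
  shows "wachs_decomposition n ` signed_wachs n =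
    {J. biclosed ((n + 1) div 2) J} \<times> Pow {1..n div 2}"
proof (intro equalityI subsetI)
  fix p assume "p \<in> wachs_decomposition n ` signed_wachs n"
  then show "p \<in> {J. biclosed ((n + 1) div 2) J} \<times> Pow {1..n div 2}"
    using biclosed_block_pairs[OF biclosed_inversions[OF signed_wachs_signed_perms]]
    by (auto simp: wachs_decomposition_def flipped_blocks_def)
next
  fix p assume "p \<in> {J. biclosed ((n + 1) div 2) J} \<times> Pow {1..n div 2}"
  then obtain J X where p: "p = (J, X)"
    and J: "biclosed ((n + 1) div 2) J" and X: "X \<subseteq> {1..n div 2}"
    by blast
  have "inflate n J X \<in> inversions n ` signed_perms n"
    using biclosed_inflate[OF J] by (simp add: inversions_image_signed_perms[OF assms])
  then obtain v where v: "v \<in> signed_perms n" "inversions n v = inflate n J X" by auto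
  then have "v \<in> signed_wachs n" by (rule signed_wachs_if_inversions_eq_inflate)
  moreover have "wachs_decomposition n v = p"
    by (simp add: wachs_decomposition_def v(2) p block_pairs_inflate[OF biclosed_subset[OF J]]
        flipped_blocks_inflate[OF X])
  ultimately show "p \<in> wachs_decomposition n ` signed_wachs n" by blast
qed

lemma weak_le_iff_wachs_decomposition:
  assumes "n > 0" and u: "u \<in> signed_wachs n" and v: "v \<in> signed_wachs n"
  shows "weak_le n u v \<longleftrightarrow>
    fst (wachs_decomposition n u) \<subseteq> fst (wachs_decomposition n v) \<and>
    snd (wachs_decomposition n u) \<subseteq> snd (wachs_decomposition n v)"
    (is "_ \<longleftrightarrow> ?le")
proof -
  have "weak_le n u v \<longleftrightarrow> inversions n u \<subseteq> inversions n v"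
    using assms by (intro weak_le_iff_inversions_subset signed_wachs_signed_perms)
  also have "\<dots> \<longleftrightarrow> ?le"
  proof
    assume "inversions n u \<subseteq> inversions n v"
    then show ?le by (auto simp: wachs_decomposition_def block_pairs_def flipped_blocks_def)
  next
    assume ?le
    then show "inversions n u \<subseteq> inversions n v"
      unfolding wachs_decomposition_def
      by (subst (1 2) signed_wachs_inversions_eq_inflate) (simp_all add: u v inflate_mono)
  qed
  finally show ?thesis .
qed

lemma partial_order_wachs_poset: "n > 0 \<Longrightarrow> partial_order (wachs_poset n)"
  unfolding wachs_poset_def
  by (rule partial_order_weak_le) (auto intro: signed_wachs_signed_perms)

lemma wachs_poset_isomorphic_biclosed_poset:
  assumes "n > 0"
  shows "poset_isomorphic (wachs_poset n)
    (prod_poset (biclosed_poset ((n + 1) div 2)) (powerset_poset {1..n div 2}))"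
    (is "poset_isomorphic _ ?Q")
proof (rule poset_isomorphicI)
  show "partial_order (wachs_poset n)" using assms by (rule partial_order_wachs_poset)
  show "partial_order ?Q"
    by (intro partial_order_prod_poset partial_order_biclosed_poset partial_order_powerset_poset)
  show "wachs_decomposition n ` carrier (wachs_poset n) = carrier ?Q"
    using wachs_decomposition_image[OF assms]
    by (simp add: wachs_poset_def prod_poset_def biclosed_poset_def powerset_poset_def)
qed (simp add: assms wachs_poset_def prod_poset_def biclosed_poset_def powerset_poset_def
    weak_le_iff_wachs_decomposition)

lemma wachs_poset_isomorphic:
  assumes "n > 0"
  shows "poset_isomorphic (wachs_poset n)
    (prod_poset (B_poset ((n + 1) div 2)) (powerset_poset {1..n div 2}))"
proof -
  let ?m = "(n + 1) div 2" and ?P = "powerset_poset {1..n div 2}"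
  have m_pos: "?m > 0" using assms by simp
  have "poset_isomorphic (wachs_poset n) (prod_poset (biclosed_poset ?m) ?P)"
    using assms by (rule wachs_poset_isomorphic_biclosed_poset)
  also have "poset_isomorphic (prod_poset (biclosed_poset ?m) ?P) (prod_poset (B_poset ?m) ?P)"
    by (intro poset_isomorphic_prod_poset poset_isomorphic_refl partial_order_powerset_poset
        poset_isomorphic_sym[OF B_poset_isomorphic_biclosed_poset[OF m_pos]])
  finally show ?thesis .
qed

lemma complemented_bounded_lattice_wachs_poset:
  assumes "n > 0"
  shows "complemented_bounded_lattice (wachs_poset n)"
proof -
  have "complemented_bounded_lattice
      (prod_poset (biclosed_poset ((n + 1) div 2)) (powerset_poset {1..n div 2}))"
    by (intro complemented_bounded_lattice_prod_poset complemented_bounded_lattice_biclosed_poset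
        complemented_bounded_lattice_powerset_poset)
  with poset_isomorphic_sym[OF wachs_poset_isomorphic_biclosed_poset[OF assms]] show ?thesis
    by (rule complemented_bounded_lattice_isomorphic)
qed

theorem theorem5p1:
  fixes n :: nat
  assumes "n > 0"
  shows "poset_isomorphic (wachs_poset n)
           (prod_poset (B_poset (nat \<lceil>real n / 2\<rceil>))
                       (powerset_poset {1..nat \<lfloor>real n / 2\<rfloor>}))
         \<and> complemented_bounded_lattice (wachs_poset n)"
proof -
  have "nat \<lceil>real n / 2\<rceil> = (n + 1) div 2" "nat \<lfloor>real n / 2\<rfloor> = n div 2" by linarith+
  then show ?thesis
    using wachs_poset_isomorphic[OF assms] complemented_bounded_lattice_wachs_poset[OF assms]
    by simp
qed

end
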